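(* Let $n\ge2$, $(\epsilon_1,\ldots,\epsilon_n)=(1,\ldots,1,0)$, $l,m\in\mathbb Z_{\ge0}$, and let $R(z)\in\mathrm{End}(\mathcal W_l\otimes\mathcal W_m)$, $z=x/y$, be the quantum $R$ matrix of $\mathcal U_A(1,\ldots,1,0)$ normalized by $R(z)(|l\mathbf e_n\rangle\otimes|m\mathbf e_n\rangle)=|l\mathbf e_n\rangle\otimes|m\mathbf e_n\rangle$. With $P(u\otimes v)=v\otimes u$, one has the spectral decomposition $$PR(z)=\sum_{s=0}^{\min(n-1,l,m)}\left(\prod_{i=1}^s\frac{1-q^{l+m-2i+2}z}{z-q^{l+m-2i+2}}\right)\mathscr P^{l,m}_s .$$
   Context: $q^{1/2},x,y$ are generic (algebraically independent indeterminates over $\mathbb C$), vector spaces are over $\mathbb C(q^{1/2},x,y)$; $[m]=\frac{q^m-q^{-m}}{q-q^{-1}}$. $F$ has basis $|m\rangle$, $m\in\mathbb Z_{\ge0}$; $V$ has basis $|0\rangle,|1\rangle$; $\mathcal W=V^{\otimes(n-1)}\otimes F$ has basis $|\mathbf m\rangle=|m_1,\ldots,m_n\rangle$ ($m_1,\ldots,m_{n-1}\in\{0,1\}$, $m_n\in\mathbb Z_{\ge0}$); $\mathcal W_l$ is the span of $|\mathbf m\rangle$ with $m_1+\cdots+m_n=l$. $\mathbf e_i$ is the $i$th standard basis vector of $\mathbb Z^n$. $\mathcal U_A(\epsilon_1,\ldots,\epsilon_n)$: put $q_i=q$ if $\epsilon_i=0$ and $q_i=-q^{-1}$ if $\epsilon_i=1$;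 indices are in $\mathbb Z/n\mathbb Z$; $D_{i,j}=\prod_{k\in\{i,i+1\}\cap\{j,j+1\}}q_k^{2\delta_{i,j}-1}$. Generators $e_i,f_i,k_i^{\pm1}$ ($0\le i\le n-1$), relations $k_ik_i^{-1}=k_i^{-1}k_i=1$, $[k_i,k_j]=0$, $k_ie_j=D_{i,j}e_jk_i$, $k_if_j=D_{i,j}^{-1}f_jk_i$, $[e_i,f_j]=\delta_{i,j}\frac{k_i-k_i^{-1}}{q-q^{-1}}$; coproduct $\Delta k_i^{\pm1}=k_i^{\pm1}\otimes k_i^{\pm1}$, $\Delta e_i=1\otimes e_i+e_i\otimes k_i$, $\Delta f_i=f_i\otimes1+k_i^{-1}\otimes f_i$; $\Delta'$ is the opposite coproduct. $\overline{\mathcal U}_A$ is the subalgebra generated by $e_i,f_i,k_i^{\pm1}$ with $1\le i\le n-1$. Representation $\pi_x$ on $\mathcal W_l$ (vectors with indices out of range are zero): $e_i|\mathbf m\rangle=x^{\delta_{i,0}}[m_i]|\mathbf m-\mathbf e_i+\mathbf e_{i+1}\rangle$, $f_i|\mathbf m\rangle=x^{-\delta_{i,0}}[m_{i+1}]|\mathbf m+\mathbf e_i-\mathbf e_{i+1}\rangle$, $k_i|\mathbf m\rangle=q_i^{-m_i}q_{i+1}^{m_{i+1}}|\mathbf m\rangle$. Quantum $R$ matrix: $R(z)$ is determined by $(\pi_x\otimes\pi_y)\Delta'(g)R(z)=R(z)(\pi_x\otimes\pi_y)\Delta(g)$ for all $g\in\mathcal U_A$ and the stated normalization. Notation $\boxtimes$: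 $(|a_1,\ldots,a_j\rangle\otimes|b_1,\ldots,b_j\rangle)\boxtimes(|a_{j+1},\ldots,a_n\rangle\otimes|b_{j+1},\ldots,b_n\rangle)=|a_1,\ldots,a_n\rangle\otimes|b_1,\ldots,b_n\rangle$, extended bilinearly. For $r\ge1$, $0\le j\le r$, $$\mathcal J_{r,j}=\sum_{(i_1,\ldots,i_r)\in\{0,1\}^r,\ i_1+\cdots+i_r=j}q^{\sum_{1\le s<t\le r}i_s(1-i_t)}|i_1,\ldots,i_r\rangle\otimes|1-i_1,\ldots,1-i_r\rangle,$$ and $\mathcal J_{0,0}$ is the empty factor. For $0\le s\le\min(n-1,l,m)$, $$\xi^{l,m}_s=(|0\rangle^{\otimes(n-s-1)}\otimes|0\rangle^{\otimes(n-s-1)})\boxtimes\sum_{j=0}^s(-1)^jq^{j(m-s+1)}\mathcal J_{s,s-j}\boxtimes(|l+j-s\rangle\otimes|m-j\rangle)\in\mathcal W_l\otimes\mathcal W_m.$$ $\mathscr P^{l,m}_s:\mathcal W_l\otimes\mathcal W_m\to\mathcal W_m\otimes\mathcal W_l$ is the linear map characterized by $\mathscr P^{l,m}_s\xi^{l,m}_{s'}=\delta_{s,s'}\xi^{m,l}_s$ for $0\le s'\le\min(n-1,l,m)$ and $(\pi_y\otimes\pi_x)\Delta(g)\mathscr P^{l,m}_s=\mathscr P^{l,m}_s(\pi_x\otimes\pi_y)\Delta(g)$ for all $g\in\overline{\mathcal U}_A$. *)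

theory Defs
  imports
    "HOL-Library.Poly_Mapping"
    "HOL-Library.Product_Plus"
    "HOL-Computational_Algebra.Polynomial"
    "HOL-Computational_Algebra.Fraction_Field"
    "HOL-Algebra.QuotRing"
    "HOL-Algebra.Generated_Rings"
begin

text \<open>The fraction field of \<open>\<complex>[q\<^sup>1\<^sup>/\<^sup>2][x][y]\<close>, i.e. \<open>\<complex>(q\<^sup>1\<^sup>/\<^sup>2, x, y)\<close>.\<close>

type_synonym scal = "complex poly poly poly fract"

definition qhalf :: scal where
  "qhalf = Fract [:[:[:0, 1:]:]:] 1"

definition qpar :: scal where
  "qpar = qhalf ^ 2"

definition xpar :: scal where
  "xpar = Fract [:[:0, 1:]:] 1"

definition ypar :: scal where
  "ypar = Fract [:0, 1:] 1"

definition qint :: "nat \<Rightarrow> scal" where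
  "qint m = (qpar ^ m - inverse qpar ^ m) / (qpar - inverse qpar)"

text \<open>
  \<open>'a \<Rightarrow>\<^sub>0 scal\<close> is the vector space with basis \<open>'a\<close>, and the tensor product of the spaces
  with bases \<open>'a\<close> and \<open>'b\<close> is the space with basis \<open>'a \<times> 'b\<close>.
\<close>

definition ket :: "'a \<Rightarrow> ('a \<Rightarrow>\<^sub>0 scal)" where
  "ket a = Poly_Mapping.single a 1"

definition smul :: "scal \<Rightarrow> ('a \<Rightarrow>\<^sub>0 scal) \<Rightarrow> ('a \<Rightarrow>\<^sub>0 scal)" where
  "smul c v = Poly_Mapping.map (\<lambda>t. c * t) v"

definition lext :: "('a \<Rightarrow> ('b \<Rightarrow>\<^sub>0 scal)) \<Rightarrow> ('a \<Rightarrow>\<^sub>0 scal) \<Rightarrow> ('b \<Rightarrow>\<^sub>0 scal)" where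
  "lext \<phi> v = (\<Sum>a\<in>Poly_Mapping.keys v. smul (Poly_Mapping.lookup v a) (\<phi> a))"

definition tens :: "('a \<Rightarrow>\<^sub>0 scal) \<Rightarrow> ('b \<Rightarrow>\<^sub>0 scal) \<Rightarrow> ('a \<times> 'b \<Rightarrow>\<^sub>0 scal)" where
  "tens u v = lext (\<lambda>a. lext (\<lambda>b. ket (a, b)) v) u"

definition flip :: "('a \<times> 'b \<Rightarrow>\<^sub>0 scal) \<Rightarrow> ('b \<times> 'a \<Rightarrow>\<^sub>0 scal)" where
  "flip = lext (\<lambda>(a, b). ket (b, a))"

definition span_of :: "'a set \<Rightarrow> ('a \<Rightarrow>\<^sub>0 scal) set" where
  "span_of B = {v. Poly_Mapping.keys v \<subseteq> B}"

definition linear_between ::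
    "('a \<Rightarrow>\<^sub>0 scal) set \<Rightarrow> ('b \<Rightarrow>\<^sub>0 scal) set \<Rightarrow> (('a \<Rightarrow>\<^sub>0 scal) \<Rightarrow> ('b \<Rightarrow>\<^sub>0 scal)) \<Rightarrow> bool" where
  "linear_between V W T \<longleftrightarrow>
     (\<forall>v\<in>V. T v \<in> W) \<and>
     (\<forall>u\<in>V. \<forall>v\<in>V. T (u + v) = T u + T v) \<and>
     (\<forall>c. \<forall>v\<in>V. T (smul c v) = smul c (T v))"

datatype gen = GE nat | GF nat | GK nat | GKinv nat

text \<open>
  Words in the generators, with concatenation written additively, so that the convolution
  product of \<open>HOL-Library.Poly_Mapping\<close> makes \<open>gword \<Rightarrow>\<^sub>0 scal\<close> the free associative algebra and
  \<open>gword \<times> gword \<Rightarrow>\<^sub>0 scal\<close> its tensor square.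
\<close>

datatype gword = GWord (letters: "gen list")

instantiation gword :: monoid_add
begin

definition "0 = GWord []"

definition "u + v = GWord (letters u @ letters v)"

instance
  by standard (simp_all add: zero_gword_def plus_gword_def)

end

type_synonym falg = "gword \<Rightarrow>\<^sub>0 scal"

definition gen_elem :: "gen \<Rightarrow> falg" where
  "gen_elem g = ket (GWord [g])"

definition const_elem :: "scal \<Rightarrow> falg" where
  "const_elem c = Poly_Mapping.single 0 c"

definition gens :: "nat set \<Rightarrow> gen set" where
  "gens I = GE ` I \<union> GF ` I \<union> GK ` I \<union> GKinv ` I"

definition free_alg :: "nat \<Rightarrow> falg ring" where
  "free_alg n =
     \<lparr>carrier = span_of {w. set (letters w) \<subseteq> gens {..<n}},
      mult = (*), one = 1, zero = 0, add = (+)\<rparr>"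

text \<open>
  Indices live in \<open>\<int>/n\<int>\<close>, while lists are indexed from 0: the \<open>i\<close>-th entry of an \<open>n\<close>-tuple,
  \<open>i \<in> \<int>/n\<int>\<close>, sits at list position \<open>slot n i\<close>; in particular \<open>slot n 1 = 0\<close> and
  \<open>slot n n = slot n 0 = n - 1\<close>.
\<close>

definition slot :: "nat \<Rightarrow> nat \<Rightarrow> nat" where
  "slot n i = (i + n - 1) mod n"

definition q_at :: "nat list \<Rightarrow> nat \<Rightarrow> scal" where
  "q_at \<epsilon> i = (if \<epsilon> ! slot (length \<epsilon>) i = 0 then qpar else - inverse qpar)"

definition D_coef :: "nat list \<Rightarrow> nat \<Rightarrow> nat \<Rightarrow> scal" where
  "D_coef \<epsilon> i j =
     (let n = length \<epsilon> in
      \<Prod>k \<in> {i mod n, (i + 1) mod n} \<inter> {j mod n, (j + 1) mod n}.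
        q_at \<epsilon> k powi (if i = j then 1 else - 1))"

definition relators :: "nat list \<Rightarrow> falg set" where
  "relators \<epsilon> =
     (let n = length \<epsilon>;
          e = (\<lambda>i. gen_elem (GE i)); f = (\<lambda>i. gen_elem (GF i));
          k = (\<lambda>i. gen_elem (GK i)); k' = (\<lambda>i. gen_elem (GKinv i))
      in {k i * k' i - 1 | i. i < n} \<union>
         {k' i * k i - 1 | i. i < n} \<union>
         {k i * k j - k j * k i | i j. i < n \<and> j < n} \<union>
         {k i * e j - const_elem (D_coef \<epsilon> i j) * (e j * k i) | i j. i < n \<and> j < n} \<union>
         {k i * f j - const_elem (inverse (D_coef \<epsilon> i j)) * (f j * k i) | i j. i < n \<and> j < n} \<union>
         {e i * f j - f j * e i -
            (if i = j then const_elem (1 / (qpar - inverse qpar)) * (k i - k' i) else 0)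
          | i j. i < n \<and> j < n})"

definition rel_ideal :: "nat list \<Rightarrow> falg set" where
  "rel_ideal \<epsilon> = genideal (free_alg (length \<epsilon>)) (relators \<epsilon>)"

definition U_A :: "nat list \<Rightarrow> falg set ring" where
  "U_A \<epsilon> = free_alg (length \<epsilon>) Quot rel_ideal \<epsilon>"

definition U_A_class :: "nat list \<Rightarrow> falg \<Rightarrow> falg set" where
  "U_A_class \<epsilon> a = rel_ideal \<epsilon> +>\<^bsub>free_alg (length \<epsilon>)\<^esub> a"

text \<open>The scalars are among the generators because \<open>generate_ring\<close> only closes under ring operations.\<close>

definition U_A_bar :: "nat list \<Rightarrow> falg set set" where
  "U_A_bar \<epsilon> =
     generate_ring (U_A \<epsilon>)
       (U_A_class \<epsilon> ` (range const_elem \<union> gen_elem ` gens {1..<length \<epsilon>}))"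

fun coprod_gen :: "gen \<Rightarrow> (gword \<times> gword \<Rightarrow>\<^sub>0 scal)" where
  "coprod_gen (GE i) = tens 1 (gen_elem (GE i)) + tens (gen_elem (GE i)) (gen_elem (GK i))"
| "coprod_gen (GF i) = tens (gen_elem (GF i)) 1 + tens (gen_elem (GKinv i)) (gen_elem (GF i))"
| "coprod_gen (GK i) = tens (gen_elem (GK i)) (gen_elem (GK i))"
| "coprod_gen (GKinv i) = tens (gen_elem (GKinv i)) (gen_elem (GKinv i))"

definition coprod :: "falg \<Rightarrow> (gword \<times> gword \<Rightarrow>\<^sub>0 scal)" where
  "coprod = lext (\<lambda>w. prod_list (map coprod_gen (letters w)))"

definition coprod_op :: "falg \<Rightarrow> (gword \<times> gword \<Rightarrow>\<^sub>0 scal)" where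
  "coprod_op a = flip (coprod a)"

definition eps :: "nat \<Rightarrow> nat list" where
  "eps n = replicate (n - 1) 1 @ [0]"

definition W_basis :: "nat \<Rightarrow> nat list set" where
  "W_basis n = {ms. length ms = n \<and> (\<forall>i < n - 1. ms ! i \<in> {0, 1})}"

definition Wl_basis :: "nat \<Rightarrow> nat \<Rightarrow> nat list set" where
  "Wl_basis n l = {ms \<in> W_basis n. sum_list ms = l}"

definition WW :: "nat \<Rightarrow> nat \<Rightarrow> nat \<Rightarrow> (nat list \<times> nat list \<Rightarrow>\<^sub>0 scal) set" where
  "WW n l m = span_of (Wl_basis n l \<times> Wl_basis n m)"

definition W_ket :: "nat \<Rightarrow> nat list \<Rightarrow> (nat list \<Rightarrow>\<^sub>0 scal)" where
  "W_ket n ms = (if ms \<in> W_basis n then ket ms else 0)"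

text \<open>
  \<open>move a b ms\<close> is \<open>ms - e\<^sub>a + e\<^sub>b\<close>.  The truncated subtraction only matters if the entry at \<open>a\<close>
  is 0, and then the coefficient \<open>qint 0 = 0\<close> of the action below vanishes.
\<close>

definition move :: "nat \<Rightarrow> nat \<Rightarrow> nat list \<Rightarrow> nat list" where
  "move a b ms = ms[a := ms ! a - 1, b := ms ! b + 1]"

fun act_gen :: "nat \<Rightarrow> scal \<Rightarrow> gen \<Rightarrow> nat list \<Rightarrow> (nat list \<Rightarrow>\<^sub>0 scal)" where
  "act_gen n x (GE i) ms =
     smul ((if i = 0 then x else 1) * qint (ms ! slot n i))
       (W_ket n (move (slot n i) (slot n (i + 1)) ms))"
| "act_gen n x (GF i) ms =
     smul ((if i = 0 then inverse x else 1) * qint (ms ! slot n (i + 1)))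
       (W_ket n (move (slot n (i + 1)) (slot n i) ms))"
| "act_gen n x (GK i) ms =
     smul (q_at (eps n) i powi (- int (ms ! slot n i)) *
           q_at (eps n) (i + 1) powi (int (ms ! slot n (i + 1))))
       (W_ket n ms)"
| "act_gen n x (GKinv i) ms =
     smul (inverse (q_at (eps n) i powi (- int (ms ! slot n i)) *
                    q_at (eps n) (i + 1) powi (int (ms ! slot n (i + 1)))))
       (W_ket n ms)"

definition rep_word :: "nat \<Rightarrow> scal \<Rightarrow> gword \<Rightarrow> (nat list \<Rightarrow>\<^sub>0 scal) \<Rightarrow> (nat list \<Rightarrow>\<^sub>0 scal)" where
  "rep_word n x w v = foldr (\<lambda>g. lext (act_gen n x g)) (letters w) v"

definition rep :: "nat \<Rightarrow> scal \<Rightarrow> falg \<Rightarrow> (nat list \<Rightarrow>\<^sub>0 scal) \<Rightarrow> (nat list \<Rightarrow>\<^sub>0 scal)" where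
  "rep n x a v = lext (\<lambda>w. rep_word n x w v) a"

text \<open>\<open>rep n x\<close> is \<open>\<pi>\<^sub>x\<close> and \<open>rep2 n x y\<close> is \<open>\<pi>\<^sub>x \<otimes> \<pi>\<^sub>y\<close>, both on representatives in the free algebra.\<close>

definition rep2 :: "nat \<Rightarrow> scal \<Rightarrow> scal \<Rightarrow> (gword \<times> gword \<Rightarrow>\<^sub>0 scal) \<Rightarrow>
    (nat list \<times> nat list \<Rightarrow>\<^sub>0 scal) \<Rightarrow> (nat list \<times> nat list \<Rightarrow>\<^sub>0 scal)" where
  "rep2 n x y T t =
     lext (\<lambda>(u, w). lext (\<lambda>(a, b). tens (rep n x (ket u) (ket a)) (rep n y (ket w) (ket b))) t) T"

text \<open>
  The relators act by zero on \<open>\<W>\<^sub>l \<otimes> \<W>\<^sub>m\<close> under both coproducts, so an element of \<open>U_A\<close>, which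
  is a coset in the free algebra, acts through any of its representatives.  The conditions
  below therefore range over all representatives \<open>a\<close> of \<open>g\<close>.
\<close>

definition is_quantum_R ::
    "nat \<Rightarrow> nat \<Rightarrow> nat \<Rightarrow>
     ((nat list \<times> nat list \<Rightarrow>\<^sub>0 scal) \<Rightarrow> (nat list \<times> nat list \<Rightarrow>\<^sub>0 scal)) \<Rightarrow> bool" where
  "is_quantum_R n l m R \<longleftrightarrow>
     linear_between (WW n l m) (WW n l m) R \<and>
     (\<forall>g \<in> carrier (U_A (eps n)). \<forall>a\<in>g. \<forall>t \<in> WW n l m.
        rep2 n xpar ypar (coprod_op a) (R t) = R (rep2 n xpar ypar (coprod a) t)) \<and>
     R (ket (replicate (n - 1) 0 @ [l], replicate (n - 1) 0 @ [m])) =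
       ket (replicate (n - 1) 0 @ [l], replicate (n - 1) 0 @ [m])"

definition boxtimes :: "(nat list \<times> nat list \<Rightarrow>\<^sub>0 scal) \<Rightarrow> (nat list \<times> nat list \<Rightarrow>\<^sub>0 scal) \<Rightarrow>
    (nat list \<times> nat list \<Rightarrow>\<^sub>0 scal)" (infixr "\<boxtimes>" 70) where
  "u \<boxtimes> v = lext (\<lambda>(a, b). lext (\<lambda>(a', b'). ket (a @ a', b @ b')) v) u"

definition J_vec :: "nat \<Rightarrow> nat \<Rightarrow> (nat list \<times> nat list \<Rightarrow>\<^sub>0 scal)" where
  "J_vec r j =
     (\<Sum>i \<in> {i. length i = r \<and> set i \<subseteq> {0, 1} \<and> sum_list i = j}.
        smul (qpar ^ (\<Sum>(s, t) \<in> {(s, t). s < t \<and> t < r}. i ! s * (1 - i ! t)))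
          (ket (i, map (\<lambda>c. 1 - c) i)))"

definition xi :: "nat \<Rightarrow> nat \<Rightarrow> nat \<Rightarrow> nat \<Rightarrow> (nat list \<times> nat list \<Rightarrow>\<^sub>0 scal)" where
  "xi n l m s =
     ket (replicate (n - s - 1) 0, replicate (n - s - 1) 0) \<boxtimes>
     (\<Sum>j = 0..s. smul ((- 1) ^ j * qpar ^ (j * (m - s + 1)))
        (J_vec s (s - j) \<boxtimes> ket ([l + j - s], [m - j])))"

definition is_scrP ::
    "nat \<Rightarrow> nat \<Rightarrow> nat \<Rightarrow> nat \<Rightarrow>
     ((nat list \<times> nat list \<Rightarrow>\<^sub>0 scal) \<Rightarrow> (nat list \<times> nat list \<Rightarrow>\<^sub>0 scal)) \<Rightarrow> bool" where
  "is_scrP n l m s P \<longleftrightarrow>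
     linear_between (WW n l m) (WW n m l) P \<and>
     (\<forall>s' \<le> Min {n - 1, l, m}. P (xi n l m s') = (if s = s' then xi n m l s else 0)) \<and>
     (\<forall>g \<in> U_A_bar (eps n). \<forall>a\<in>g. \<forall>t \<in> WW n l m.
        rep2 n ypar xpar (coprod a) (P t) = P (rep2 n xpar ypar (coprod a) t))"

end

theory Submission
  imports Defs
begin

text \<open>
  The operator \<open>T = P R(z)\<close> intertwines the coproduct \<open>\<Delta>\<close> on \<open>\<W>\<^sub>l \<otimes> \<W>\<^sub>m\<close> with \<open>\<Delta>\<close> on
  \<open>\<W>\<^sub>m \<otimes> \<W>\<^sub>l\<close>, with the spectral parameters exchanged.  The proof rests on two independent facts.

  Eigenvalues.  The vector \<open>\<xi>\<^sub>s\<close> is annihilated by \<open>e\<^sub>1, \<dots>, e\<^sub>n\<^sub>-\<^sub>1\<close> (\<open>raise_hwv\<close>), and a vector with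
  this property is determined by its coefficients at \<open>|l e\<^sub>n\<rangle> \<otimes> |b\<rangle>\<close> (\<open>raise_kernel\<close>).  On the weight
  space of \<open>\<xi>\<^sub>s\<close> there is one such coefficient.  Since \<open>T\<close> preserves weights (\<open>T_support\<close>), it
  maps \<open>\<xi>\<^sub>s\<close> to \<open>\<rho>\<^sub>s\<close> times its counterpart in \<open>\<W>\<^sub>m \<otimes> \<W>\<^sub>l\<close>.  The product \<open>f\<^sub>0 f\<^sub>1 \<cdots> f\<^sub>n\<^sub>-\<^sub>s\<^sub>-\<^sub>1\<close> carries the first of
  the \<open>s\<close> fermions of \<open>\<xi>\<^sub>s\<close> leftwards to site 1 and from there to the bosonic site, and the result is
  exactly \<open>(1/x - q\<^sup>l\<^sup>+\<^sup>m\<^sup>-\<^sup>2\<^sup>s\<^sup>+\<^sup>2/y) \<xi>\<^sub>s\<^sub>-\<^sub>1\<close> (\<open>lower_hwv\<close>, \<open>affine_raise_hwv\<close>).  Applying \<open>T\<close> exchanges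
  \<open>x\<close> and \<open>y\<close> in this factor, so \<open>\<rho>\<^sub>s / \<rho>\<^sub>s\<^sub>-\<^sub>1\<close> is the \<open>s\<close>-th factor of the product (\<open>T_hwv\<close>).

  Generation.  An intertwiner of the finite subalgebra that kills all \<open>\<xi>\<^sub>s\<close> is zero
  (\<open>intertwiner_eq_0\<close>); applied to the difference of the two sides, this gives the theorem.  The
  proof is an induction on the deficit, the number of lowering steps that separate a basis vector
  from \<open>|l e\<^sub>n\<rangle> \<otimes> |m e\<^sub>n\<rangle>\<close>.  Modulo smaller deficits every basis vector becomes a multiple of a single
  vector \<open>|l e\<^sub>n\<rangle> \<otimes> |b\<^sub>s\<rangle>\<close>, where \<open>b\<^sub>s\<close> has its fermions on the last \<open>s\<close> sites, and \<open>\<xi>\<^sub>s\<close> becomes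
  \<open>c |l e\<^sub>n\<rangle> \<otimes> |b\<^sub>s\<rangle>\<close> with a constant \<open>c\<close> that is the same for all intertwiners.  That \<open>c \<noteq> 0\<close> needs no
  computation: \<open>\<P>\<^sub>s\<close> kills the smaller deficits as well, and \<open>\<P>\<^sub>s \<xi>\<^sub>s \<noteq> 0\<close>.
\<close>

section \<open>Linear algebra on spaces with a basis\<close>

abbreviation coord :: "('a \<Rightarrow>\<^sub>0 scal) \<Rightarrow> 'a \<Rightarrow> scal" where
  "coord \<equiv> Poly_Mapping.lookup"

abbreviation supp :: "('a \<Rightarrow>\<^sub>0 scal) \<Rightarrow> 'a set" where
  "supp \<equiv> Poly_Mapping.keys"

lemma lookup_smul [simp]: "coord (smul c v) k = c * coord v k"
  by (simp add: smul_def Poly_Mapping.map.rep_eq when_def)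

lemma lookup_ket: "coord (ket a) k = (if k = a then 1 else 0)"
  by (auto simp: ket_def lookup_single when_def)

lemma smul_add: "smul c (u + v) = smul c u + smul c v"
  by (rule poly_mapping_eqI) (simp add: lookup_add algebra_simps)

lemma smul_diff: "smul c (u - v) = smul c u - smul c v"
  by (rule poly_mapping_eqI) (simp add: lookup_minus algebra_simps)

lemma smul_add_left: "smul (c + d) v = smul c v + smul d v"
  by (rule poly_mapping_eqI) (simp add: lookup_add algebra_simps)

lemma smul_smul [simp]: "smul c (smul d v) = smul (c * d) v"
  by (rule poly_mapping_eqI) simp

lemma smul_0 [simp]: "smul 0 v = 0"
  by (rule poly_mapping_eqI) simp

lemma smul_0_right [simp]: "smul c 0 = 0"
  by (rule poly_mapping_eqI) simp

lemma smul_1 [simp]: "smul 1 v = v"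
  by (rule poly_mapping_eqI) simp

lemma smul_eq_0_iff: "smul c v = 0 \<longleftrightarrow> c = 0 \<or> v = 0"
proof
  assume *: "smul c v = 0"
  show "c = 0 \<or> v = 0"
  proof (rule ccontr)
    assume "\<not> (c = 0 \<or> v = 0)"
    then obtain k where "coord v k \<noteq> 0" "c \<noteq> 0" by (metis lookup_zero poly_mapping_eqI)
    moreover have "c * coord v k = 0" using arg_cong[OF *, of "\<lambda>v. coord v k"] by simp
    ultimately show False by simp
  qed
qed auto

lemma smul_sum: "smul c (\<Sum>a\<in>A. f a) = (\<Sum>a\<in>A. smul c (f a))"
  by (induction A rule: infinite_finite_induct) (auto simp: smul_add)

lemma smul_sum_left: "smul (\<Sum>a\<in>A. c a) v = (\<Sum>a\<in>A. smul (c a) v)"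
  by (induction A rule: infinite_finite_induct) (auto simp: smul_add_left)

lemma lookup_lext:
  "coord (lext \<phi> v) t = (\<Sum>a\<in>supp v. coord v a * coord (\<phi> a) t)"
  by (simp add: lext_def lookup_sum)

lemma lext_superset:
  assumes "finite A" "supp v \<subseteq> A"
  shows "lext \<phi> v = (\<Sum>a\<in>A. smul (coord v a) (\<phi> a))"
  unfolding lext_def using assms
  by (intro sum.mono_neutral_left) (auto simp: in_keys_iff)

lemma lext_add: "lext \<phi> (u + v) = lext \<phi> u + lext \<phi> v"
proof -
  let ?A = "supp u \<union> supp v"
  have "supp (u + v) \<subseteq> ?A" by (rule Poly_Mapping.keys_add)
  then show ?thesis
    by (simp add: lext_superset[of ?A] lookup_add smul_add_left sum.distrib)
qed

lemma lext_smul: "lext \<phi> (smul c v) = smul c (lext \<phi> v)"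
proof -
  have "supp (smul c v) \<subseteq> supp v" by (auto simp: in_keys_iff)
  then show ?thesis
    by (simp add: lext_superset[of "supp v"] smul_sum)
qed

lemma lext_0 [simp]: "lext \<phi> 0 = 0"
  by (simp add: lext_def)

lemma lext_sum: "lext \<phi> (\<Sum>a\<in>A. f a) = (\<Sum>a\<in>A. lext \<phi> (f a))"
  by (induction A rule: infinite_finite_induct) (auto simp: lext_add)

lemma lext_diff: "lext \<phi> (u - v) = lext \<phi> u - lext \<phi> v"
  using lext_add[of \<phi> "u - v" v] by (simp add: eq_diff_eq)

lemma lext_ket [simp]: "lext \<phi> (ket a) = \<phi> a"
  by (simp add: lext_def ket_def)

lemma lext_cong: "(\<And>a. a \<in> supp v \<Longrightarrow> \<phi> a = \<psi> a) \<Longrightarrow> lext \<phi> v = lext \<psi> v"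
  by (simp add: lext_def)

lemma lext_fun_add: "lext (\<lambda>a. \<phi> a + \<psi> a) v = lext \<phi> v + lext \<psi> v"
  by (simp add: lext_def smul_add sum.distrib)

lemma ket_expansion: "v = (\<Sum>a\<in>supp v. smul (coord v a) (ket a))"
  by (rule poly_mapping_eqI) (simp add: lookup_sum lookup_ket if_distrib sum.delta' in_keys_iff cong: if_cong)

lemma lext_lext: "lext \<phi> (lext \<psi> v) = lext (\<lambda>a. lext \<phi> (\<psi> a)) v"
  by (simp add: lext_def[of \<psi>] lext_sum lext_smul) (simp add: lext_def)

lemma lookup_tens: "coord (tens u v) (a, b) = coord u a * coord v b"
proof -
  have *: "coord (lext (\<lambda>b. ket (a', b)) v) (a, b) = (if a' = a then coord v b else 0)" for a'
    by (auto simp: lookup_lext lookup_ket if_distrib sum.delta' in_keys_iff cong: if_cong)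
  show ?thesis
    unfolding tens_def
    by (subst lookup_lext) (simp add: * if_distrib sum.delta in_keys_iff cong: if_cong)
qed

lemma tens_smul_left: "tens (smul c u) v = smul c (tens u v)"
  by (rule poly_mapping_eqI) (auto simp: lookup_tens)

lemma tens_smul_right: "tens u (smul c v) = smul c (tens u v)"
  by (rule poly_mapping_eqI) (auto simp: lookup_tens)

lemma tens_ket [simp]: "tens (ket a) (ket b) = ket (a, b)"
  by (simp add: tens_def)

lemma tens_0 [simp]: "tens 0 v = 0" "tens u 0 = 0"
  by (auto intro!: poly_mapping_eqI simp: lookup_tens)

lemma flip_ket [simp]: "flip (ket (a, b)) = ket (b, a)"
  by (simp add: flip_def)

lemma lookup_flip: "coord (flip v) (b, a) = coord v (a, b)"
proof -
  have "coord (flip v) (b, a) = (\<Sum>k\<in>supp v. if k = (a, b) then coord v k else 0)"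
    unfolding flip_def lookup_lext by (rule sum.cong) (auto simp: lookup_ket split: prod.splits)
  then show ?thesis by (simp add: sum.delta in_keys_iff)
qed

lemma flip_tens: "flip (tens u v) = tens v u"
  by (rule poly_mapping_eqI) (auto simp: lookup_tens lookup_flip)

lemma flip_lext: "flip (lext \<phi> v) = lext (\<lambda>a. flip (\<phi> a)) v"
  by (simp add: flip_def lext_lext)

lemma lext_flip: "lext \<phi> (flip v) = lext (\<lambda>(a, b). \<phi> (b, a)) v"
  by (simp add: flip_def lext_lext case_prod_unfold)

text \<open>Conjugation by \<open>P\<close> turns \<open>\<Delta>'\<close> into \<open>\<Delta>\<close> and exchanges the spectral parameters.\<close>

lemma flip_rep2: "flip (rep2 n x y (flip T) t) = rep2 n y x T (flip t)"
  unfolding rep2_def lext_flip flip_lext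
  by (simp add: case_prod_unfold flip_lext flip_tens)

section \<open>The coefficient field\<close>

lemma qhalf_power: "qhalf ^ k = Fract [:[:Polynomial.monom 1 k:]:] 1"
proof (induction k)
  case 0
  then show ?case by (simp add: One_fract_def one_pCons)
next
  case (Suc k)
  then show ?case by (simp add: qhalf_def Polynomial.monom_Suc mult.commute)
qed

lemma qpar_power: "qpar ^ k = Fract [:[:Polynomial.monom 1 (2 * k):]:] 1"
  unfolding qpar_def power_mult[symmetric] by (rule qhalf_power)

lemma qpar_nonzero [simp]: "qpar \<noteq> 0"
proof -
  have "qhalf \<noteq> 0" by (simp add: qhalf_def Zero_fract_def eq_fract)
  then show ?thesis by (simp add: qpar_def)
qed

lemma qpar_power_eq_iff: "qpar ^ j = qpar ^ k \<longleftrightarrow> j = k"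
  by (simp add: qpar_power eq_fract Polynomial.monom_eq_iff')

lemma qpar_power_eq_1_iff: "qpar ^ k = 1 \<longleftrightarrow> k = 0"
  using qpar_power_eq_iff[of k 0] by simp

lemma qpar_powi_eq_iff: "qpar powi i = qpar powi j \<longleftrightarrow> i = j"
proof
  assume "qpar powi i = qpar powi j"
  then have "qpar powi (i - j) = 1" "qpar powi (j - i) = 1" by (simp_all add: power_int_diff)
  then show "i = j"
    by (cases "i \<ge> j") (auto simp: power_int_def qpar_power_eq_1_iff split: if_splits)
qed simp

lemma qint_nonzero: "k > 0 \<Longrightarrow> qint k \<noteq> 0"
proof -
  have *: "qpar ^ k - inverse qpar ^ k \<noteq> 0" if "k > 0" for k
  proof
    assume "qpar ^ k - inverse qpar ^ k = 0"
    then have "qpar ^ k * qpar ^ k = 1" by (simp add: power_inverse field_simps)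
    then have "qpar ^ (k + k) = 1" by (simp add: power_add)
    then show False using that by (simp add: qpar_power_eq_1_iff)
  qed
  from *[of 1] *[of k] show "k > 0 \<Longrightarrow> qint k \<noteq> 0" by (simp add: qint_def)
qed

lemma qint_0 [simp]: "qint 0 = 0"
  by (simp add: qint_def)

lemma qint_1 [simp]: "qint 1 = 1" "qint (Suc 0) = 1"
proof -
  have "qpar * qpar \<noteq> 1" using qpar_power_eq_1_iff[of 2] by (simp add: power2_eq_square)
  then have "qpar - inverse qpar \<noteq> 0" by (auto simp: field_simps)
  then show "qint 1 = 1" "qint (Suc 0) = 1" by (simp_all add: qint_def)
qed

lemma xpar_nonzero [simp]: "xpar \<noteq> 0" and ypar_nonzero [simp]: "ypar \<noteq> 0"
  by (simp_all add: xpar_def ypar_def Zero_fract_def eq_fract)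

lemma xpar_minus_power_ypar: "xpar - qpar ^ k * ypar \<noteq> 0"
  by (simp add: xpar_def ypar_def qpar_power Zero_fract_def eq_fract)

section \<open>The generators on a tensor product\<close>

definition site_q :: "nat \<Rightarrow> nat \<Rightarrow> scal" where
  "site_q n p = (if p = n - 1 then qpar else - inverse qpar)"

definition weight :: "nat \<Rightarrow> nat \<Rightarrow> nat \<Rightarrow> nat list \<Rightarrow> scal" where
  "weight n p r a = site_q n p powi (- int (a ! p)) * site_q n r powi int (a ! r)"

definition hop :: "nat \<Rightarrow> nat \<Rightarrow> nat \<Rightarrow> nat list \<Rightarrow> (nat list \<Rightarrow>\<^sub>0 scal)" where
  "hop n p r a = smul (qint (a ! p)) (W_ket n (move p r a))"

text \<open>
  The common shape of the coproducts of all \<open>e\<^sub>i\<close> and \<open>f\<^sub>i\<close>: a particle hops from \<open>p\<close> to \<open>r\<close> in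
  one factor, and the other factor contributes a scalar.
\<close>

definition hop2 :: "nat \<Rightarrow> nat \<Rightarrow> nat \<Rightarrow> (nat list \<Rightarrow> scal) \<Rightarrow> (nat list \<Rightarrow> scal) \<Rightarrow>
    (nat list \<times> nat list \<Rightarrow>\<^sub>0 scal) \<Rightarrow> (nat list \<times> nat list \<Rightarrow>\<^sub>0 scal)" where
  "hop2 n p r \<alpha> \<beta> =
     lext (\<lambda>(a, b). smul (\<alpha> b) (tens (hop n p r a) (ket b)) + smul (\<beta> a) (tens (ket a) (hop n p r b)))"

definition cartan :: "nat \<Rightarrow> nat \<Rightarrow> nat \<Rightarrow>
    (nat list \<times> nat list \<Rightarrow>\<^sub>0 scal) \<Rightarrow> (nat list \<times> nat list \<Rightarrow>\<^sub>0 scal)" where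
  "cartan n p r = lext (\<lambda>(a, b). smul (weight n p r a * weight n p r b) (ket (a, b)))"

text \<open>\<open>raise n p\<close> and \<open>lower n p\<close> are \<open>e\<^sub>p\<^sub>+\<^sub>1\<close> and \<open>f\<^sub>p\<^sub>+\<^sub>1\<close>; the affine \<open>f\<^sub>0\<close> moves a particle
  to the bosonic site and so plays the part of a raising operator.\<close>

definition raise where
  "raise n p = hop2 n p (Suc p) (weight n p (Suc p)) (\<lambda>_. 1)"

definition lower where
  "lower n p = hop2 n (Suc p) p (\<lambda>_. 1) (\<lambda>a. inverse (weight n p (Suc p) a))"

definition affine_raise where
  "affine_raise n x y =
     hop2 n 0 (n - 1) (\<lambda>_. inverse x) (\<lambda>a. inverse y * inverse (weight n (n - 1) 0 a))"

definition affine_lower where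
  "affine_lower n x y = hop2 n (n - 1) 0 (\<lambda>b. x * weight n (n - 1) 0 b) (\<lambda>_. y)"

lemma q_at_eps: "n \<ge> 1 \<Longrightarrow> q_at (eps n) i = site_q n (slot n i)"
proof -
  assume "n \<ge> 1"
  then have "length (eps n) = n" "slot n i < n" by (auto simp: eps_def slot_def)
  then show ?thesis by (auto simp: q_at_def site_q_def eps_def nth_append)
qed

lemma act_gen_eq:
  assumes "n \<ge> 1"
  shows "act_gen n x (GE i) a = smul (if i = 0 then x else 1) (hop n (slot n i) (slot n (i + 1)) a)"
    and "act_gen n x (GF i) a = smul (if i = 0 then inverse x else 1) (hop n (slot n (i + 1)) (slot n i) a)"
    and "act_gen n x (GK i) a = smul (weight n (slot n i) (slot n (i + 1)) a) (W_ket n a)"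
    and "act_gen n x (GKinv i) a = smul (inverse (weight n (slot n i) (slot n (i + 1)) a)) (W_ket n a)"
  using assms by (simp_all add: hop_def weight_def q_at_eps)

lemma rep2_kets:
  "rep2 n x y (ket (u, w)) t =
     lext (\<lambda>(a, b). tens (rep_word n x u (ket a)) (rep_word n y w (ket b))) t"
  by (simp add: rep2_def rep_def)

lemma rep2_add: "rep2 n x y (T + T') t = rep2 n x y T t + rep2 n x y T' t"
  by (simp add: rep2_def lext_add)

lemma rep_word_gen: "rep_word n x (GWord [g]) (ket a) = act_gen n x g a"
  by (simp add: rep_word_def)

lemma rep_word_0: "rep_word n x 0 v = v"
  by (simp add: rep_word_def zero_gword_def)

lemma one_ket: "(1 :: falg) = ket 0"
  by (simp add: ket_def)

lemma coprod_gen_elem: "coprod (gen_elem g) = coprod_gen g"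
  by (simp add: coprod_def gen_elem_def)

lemmas rep2_simps = coprod_gen_elem one_ket gen_elem_def rep2_add rep2_kets rep_word_0 rep_word_gen

lemma W_ket_in: "a \<in> W_basis n \<Longrightarrow> W_ket n a = ket a"
  by (simp add: W_ket_def)

lemma rep2_coprod_E:
  assumes "n \<ge> 1" and "supp v \<subseteq> W_basis n \<times> W_basis n"
  shows "rep2 n x y (coprod (gen_elem (GE i))) v =
    hop2 n (slot n i) (slot n (i + 1))
      (\<lambda>b. (if i = 0 then x else 1) * weight n (slot n i) (slot n (i + 1)) b)
      (\<lambda>_. if i = 0 then y else 1) v"
proof -
  have "rep2 n x y (coprod (gen_elem (GE i))) v =
    lext (\<lambda>(a, b). tens (ket a) (act_gen n y (GE i) b)) v +
    lext (\<lambda>(a, b). tens (act_gen n x (GE i) a) (act_gen n y (GK i) b)) v"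
    unfolding coprod_gen_elem coprod_gen.simps by (simp add: rep2_simps del: act_gen.simps)
  also have "\<dots> = lext (\<lambda>k. (\<lambda>(a, b). tens (ket a) (act_gen n y (GE i) b)) k +
    (\<lambda>(a, b). tens (act_gen n x (GE i) a) (act_gen n y (GK i) b)) k) v"
    by (rule lext_fun_add[symmetric])
  also have "\<dots> = hop2 n (slot n i) (slot n (i + 1))
      (\<lambda>b. (if i = 0 then x else 1) * weight n (slot n i) (slot n (i + 1)) b)
      (\<lambda>_. if i = 0 then y else 1) v"
    unfolding hop2_def
  proof (rule lext_cong)
    fix k assume "k \<in> supp v"
    then obtain a b where k: "k = (a, b)" "b \<in> W_basis n" using assms(2) by auto
    show "(\<lambda>(a, b). tens (ket a) (act_gen n y (GE i) b)) k +
      (\<lambda>(a, b). tens (act_gen n x (GE i) a) (act_gen n y (GK i) b)) k =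
      (\<lambda>(a, b). smul ((if i = 0 then x else 1) * weight n (slot n i) (slot n (i + 1)) b)
         (tens (hop n (slot n i) (slot n (i + 1)) a) (ket b)) +
       smul (if i = 0 then y else 1) (tens (ket a) (hop n (slot n i) (slot n (i + 1)) b))) k"
      unfolding k(1) prod.case act_gen_eq[OF assms(1)] W_ket_in[OF k(2)]
      by (simp only: tens_smul_left tens_smul_right smul_smul mult.commute add.commute)
  qed
  finally show ?thesis .
qed

lemma rep2_coprod_F:
  assumes "n \<ge> 1" and "supp v \<subseteq> W_basis n \<times> W_basis n"
  shows "rep2 n x y (coprod (gen_elem (GF i))) v =
    hop2 n (slot n (i + 1)) (slot n i)
      (\<lambda>_. if i = 0 then inverse x else 1)
      (\<lambda>a. (if i = 0 then inverse y else 1) * inverse (weight n (slot n i) (slot n (i + 1)) a)) v"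
proof -
  have "rep2 n x y (coprod (gen_elem (GF i))) v =
    lext (\<lambda>(a, b). tens (act_gen n x (GF i) a) (ket b)) v +
    lext (\<lambda>(a, b). tens (act_gen n x (GKinv i) a) (act_gen n y (GF i) b)) v"
    unfolding coprod_gen_elem coprod_gen.simps by (simp add: rep2_simps del: act_gen.simps)
  also have "\<dots> = lext (\<lambda>k. (\<lambda>(a, b). tens (act_gen n x (GF i) a) (ket b)) k +
    (\<lambda>(a, b). tens (act_gen n x (GKinv i) a) (act_gen n y (GF i) b)) k) v"
    by (rule lext_fun_add[symmetric])
  also have "\<dots> = hop2 n (slot n (i + 1)) (slot n i)
      (\<lambda>_. if i = 0 then inverse x else 1)
      (\<lambda>a. (if i = 0 then inverse y else 1) * inverse (weight n (slot n i) (slot n (i + 1)) a)) v"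
    unfolding hop2_def
  proof (rule lext_cong)
    fix k assume "k \<in> supp v"
    then obtain a b where k: "k = (a, b)" "a \<in> W_basis n" using assms(2) by auto
    show "(\<lambda>(a, b). tens (act_gen n x (GF i) a) (ket b)) k +
      (\<lambda>(a, b). tens (act_gen n x (GKinv i) a) (act_gen n y (GF i) b)) k =
      (\<lambda>(a, b). smul (if i = 0 then inverse x else 1)
         (tens (hop n (slot n (i + 1)) (slot n i) a) (ket b)) +
       smul ((if i = 0 then inverse y else 1) * inverse (weight n (slot n i) (slot n (i + 1)) a))
         (tens (ket a) (hop n (slot n (i + 1)) (slot n i) b))) k"
      unfolding k(1) prod.case act_gen_eq[OF assms(1)] W_ket_in[OF k(2)]
      by (simp only: tens_smul_left tens_smul_right smul_smul mult.commute)
  qed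
  finally show ?thesis .
qed

lemma rep2_coprod_K:
  assumes "n \<ge> 1" and "supp v \<subseteq> W_basis n \<times> W_basis n"
  shows "rep2 n x y (coprod (gen_elem (GK i))) v = cartan n (slot n i) (slot n (i + 1)) v"
proof -
  have "rep2 n x y (coprod (gen_elem (GK i))) v =
    lext (\<lambda>(a, b). tens (act_gen n x (GK i) a) (act_gen n y (GK i) b)) v"
    unfolding coprod_gen_elem coprod_gen.simps by (simp add: rep2_simps del: act_gen.simps)
  also have "\<dots> = cartan n (slot n i) (slot n (i + 1)) v"
    unfolding cartan_def
  proof (rule lext_cong)
    fix k assume "k \<in> supp v"
    then obtain a b where k: "k = (a, b)" "a \<in> W_basis n" "b \<in> W_basis n" using assms(2) by auto
    show "(\<lambda>(a, b). tens (act_gen n x (GK i) a) (act_gen n y (GK i) b)) k =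
      (\<lambda>(a, b). smul (weight n (slot n i) (slot n (i + 1)) a *
         weight n (slot n i) (slot n (i + 1)) b) (ket (a, b))) k"
      unfolding k(1) prod.case act_gen_eq[OF assms(1)] W_ket_in[OF k(2)] W_ket_in[OF k(3)]
      by (simp only: tens_smul_left tens_smul_right smul_smul tens_ket mult.commute)
  qed
  finally show ?thesis .
qed

lemma slot_simps:
  assumes "n \<ge> 2"
  shows "slot n 0 = n - 1" "slot n (Suc 0) = 0" "\<lbrakk>1 \<le> i; i \<le> n\<rbrakk> \<Longrightarrow> slot n i = i - 1"
proof -
  show "slot n i = i - 1" if "1 \<le> i" "i \<le> n"
  proof -
    have "i + n - 1 = (i - 1) + n" using that by simp
    then have "slot n i = (i - 1) mod n" by (simp only: slot_def mod_add_self2)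
    also have "\<dots> = i - 1" using that by (intro mod_less) auto
    finally show ?thesis .
  qed
qed (use assms in \<open>auto simp: slot_def\<close>)

lemma rep2_finite:
  assumes "n \<ge> 2" "p < n - 1" "supp v \<subseteq> W_basis n \<times> W_basis n"
  shows "rep2 n x y (coprod (gen_elem (GE (Suc p)))) v = raise n p v"
    and "rep2 n x y (coprod (gen_elem (GF (Suc p)))) v = lower n p v"
    and "rep2 n x y (coprod (gen_elem (GK (Suc p)))) v = cartan n p (Suc p) v"
  using assms
  by (simp_all add: rep2_coprod_E rep2_coprod_F rep2_coprod_K raise_def lower_def slot_simps)

lemma rep2_affine:
  assumes "n \<ge> 2" "supp v \<subseteq> W_basis n \<times> W_basis n"
  shows "rep2 n x y (coprod (gen_elem (GE 0))) v = affine_lower n x y v"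
    and "rep2 n x y (coprod (gen_elem (GF 0))) v = affine_raise n x y v"
  using assms
  by (simp_all add: rep2_coprod_E rep2_coprod_F affine_raise_def affine_lower_def slot_simps)

lemma length_move [simp]: "length (move p r a) = length a"
  by (simp add: move_def)

lemma nth_move:
  assumes "p \<noteq> r" "p < length a" "r < length a"
  shows "move p r a ! i = (if i = p then a ! p - 1 else if i = r then a ! r + 1 else a ! i)"
  using assms by (auto simp: move_def nth_list_update)

lemma move_move:
  assumes "p \<noteq> r" "p < length a" "r < length a" "a ! p \<ge> 1"
  shows "move r p (move p r a) = a"
  using assms by (intro nth_equalityI) (auto simp: nth_move)

lemma sum_list_move:
  assumes "p \<noteq> r" "p < length a" "r < length a" "a ! p \<ge> 1"
  shows "sum_list (move p r a) = sum_list a"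
proof -
  have "a ! p \<le> sum_list a" using assms by (intro member_le_sum_list) auto
  then show ?thesis using assms by (simp add: move_def sum_list_update)
qed

lemma coord_hop:
  assumes "p \<noteq> r" "p < n" "r < n" "length a0 = n"
  shows "coord (hop n p r a0) a =
    (if a0 = move r p a \<and> a \<in> W_basis n \<and> a ! r \<ge> 1 then qint (a ! p + 1) else 0)"
proof (cases "a \<in> W_basis n")
  case False
  then show ?thesis by (auto simp: hop_def W_ket_def lookup_ket)
next
  case True
  then have len: "length a = n" by (simp add: W_basis_def)
  show ?thesis
  proof (cases "a0 ! p \<ge> 1")
    case True
    show ?thesis
    proof (cases "a0 = move r p a \<and> a ! r \<ge> 1")
      case 1: True
      then have "move p r a0 = a" "a0 ! p = a ! p + 1"
        using assms len by (simp_all add: move_move nth_move)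
      then show ?thesis using 1 \<open>a \<in> W_basis n\<close> by (simp add: hop_def W_ket_def lookup_ket)
    next
      case 2: False
      have "move p r a0 \<noteq> a"
      proof
        assume *: "move p r a0 = a"
        then have "a0 = move r p a" using move_move[of p r a0] assms True by simp
        moreover have "a ! r \<ge> 1" using assms nth_move[of p r a0 r] * by simp
        ultimately show False using 2 by blast
      qed
      then have "coord (hop n p r a0) a = 0" by (simp add: hop_def W_ket_def lookup_ket)
      with 2 show ?thesis by (simp only:) auto
    qed
  next
    case False
    have "a0 \<noteq> move r p a"
    proof
      assume "a0 = move r p a"
      then have "a0 ! p = a ! p + 1" using nth_move[of r p a p] assms len by simp
      with False show False by simp
    qed
    moreover have "coord (hop n p r a0) a = 0" using False by (simp add: hop_def not_le)
    ultimately show ?thesis by simp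
  qed
qed

text \<open>
  A basis vector is hit from at most two others, one per factor; reading the action through
  coordinates turns the equation \<open>e\<^sub>i v = 0\<close> into two-term relations.
\<close>

lemma coord_hop2:
  assumes "p \<noteq> r" "p < n" "r < n" "supp v \<subseteq> W_basis n \<times> W_basis n"
  shows "coord (hop2 n p r \<alpha> \<beta> v) (a, b) =
    (if a \<in> W_basis n \<and> a ! r \<ge> 1 then qint (a ! p + 1) * \<alpha> b * coord v (move r p a, b) else 0) +
    (if b \<in> W_basis n \<and> b ! r \<ge> 1 then qint (b ! p + 1) * \<beta> a * coord v (a, move r p b) else 0)"
proof -
  have len: "length a0 = n \<and> length b0 = n" if "(a0, b0) \<in> supp v" for a0 b0
    using that assms(4) by (auto simp: W_basis_def)
  have "coord (hop2 n p r \<alpha> \<beta> v) (a, b) =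
     (\<Sum>k\<in>supp v. (if k = (move r p a, b) then
          (if a \<in> W_basis n \<and> a ! r \<ge> 1 then qint (a ! p + 1) * \<alpha> b * coord v k else 0) else 0) +
        (if k = (a, move r p b) then
          (if b \<in> W_basis n \<and> b ! r \<ge> 1 then qint (b ! p + 1) * \<beta> a * coord v k else 0) else 0))"
    unfolding hop2_def lookup_lext
  proof (rule sum.cong[OF refl])
    fix k assume k: "k \<in> supp v"
    obtain a0 b0 where ab: "k = (a0, b0)" by force
    have len': "length a0 = n" "length b0 = n" using len k ab by blast+
    have c1: "coord (tens (hop n p r a0) (ket b0)) (a, b) = (if k = (move r p a, b) then
        (if a \<in> W_basis n \<and> a ! r \<ge> 1 then qint (a ! p + 1) else 0) else 0)"
      by (simp add: ab lookup_tens lookup_ket coord_hop[OF assms(1-3) len'(1)])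
    have c2: "coord (tens (ket a0) (hop n p r b0)) (a, b) = (if k = (a, move r p b) then
        (if b \<in> W_basis n \<and> b ! r \<ge> 1 then qint (b ! p + 1) else 0) else 0)"
      by (simp add: ab lookup_tens lookup_ket coord_hop[OF assms(1-3) len'(2)])
    have d1: "k = (move r p a, b) \<Longrightarrow> \<alpha> b0 = \<alpha> b" and d2: "k = (a, move r p b) \<Longrightarrow> \<beta> a0 = \<beta> a"
      using ab by simp_all
    show "coord v k * coord (case k of (a, b) \<Rightarrow> smul (\<alpha> b) (tens (hop n p r a) (ket b)) +
        smul (\<beta> a) (tens (ket a) (hop n p r b))) (a, b) =
      (if k = (move r p a, b) then
          (if a \<in> W_basis n \<and> a ! r \<ge> 1 then qint (a ! p + 1) * \<alpha> b * coord v k else 0) else 0) +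
        (if k = (a, move r p b) then
          (if b \<in> W_basis n \<and> b ! r \<ge> 1 then qint (b ! p + 1) * \<beta> a * coord v k else 0) else 0)"
      unfolding ab prod.case lookup_add lookup_smul c1[unfolded ab] c2[unfolded ab]
      using d1[unfolded ab] d2[unfolded ab] by (simp add: distrib_left)
  qed
  also have "\<dots> = (if a \<in> W_basis n \<and> a ! r \<ge> 1 then qint (a ! p + 1) * \<alpha> b * coord v (move r p a, b) else 0) +
    (if b \<in> W_basis n \<and> b ! r \<ge> 1 then qint (b ! p + 1) * \<beta> a * coord v (a, move r p b) else 0)"
    by (simp add: sum.distrib sum.delta in_keys_iff)
  finally show ?thesis .
qed

lemma coord_cartan: "coord (cartan n p r v) (a, b) = weight n p r a * weight n p r b * coord v (a, b)"
proof -
  have "coord (cartan n p r v) (a, b) =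
      (\<Sum>k\<in>supp v. if k = (a, b) then weight n p r a * weight n p r b * coord v k else 0)"
    unfolding cartan_def lookup_lext by (rule sum.cong) (auto simp: lookup_ket split: if_splits)
  then show ?thesis by (simp add: sum.delta in_keys_iff)
qed

lemma WW_iff:
  "v \<in> WW n l m \<longleftrightarrow> (\<forall>a b. coord v (a, b) \<noteq> 0 \<longrightarrow> a \<in> Wl_basis n l \<and> b \<in> Wl_basis n m)"
  by (auto simp: WW_def span_of_def in_keys_iff subset_iff)

lemma WW_supp: "v \<in> WW n l m \<Longrightarrow> supp v \<subseteq> W_basis n \<times> W_basis n"
  by (auto simp: WW_def span_of_def Wl_basis_def)

lemma WW_closed:
  "0 \<in> WW n l m" "u \<in> WW n l m \<Longrightarrow> v \<in> WW n l m \<Longrightarrow> u + v \<in> WW n l m"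
  "u \<in> WW n l m \<Longrightarrow> v \<in> WW n l m \<Longrightarrow> u - v \<in> WW n l m"
  "u \<in> WW n l m \<Longrightarrow> smul c u \<in> WW n l m"
  by (auto simp: WW_iff lookup_add lookup_minus) (metis add_0 diff_zero)+

lemma WW_sum: "(\<And>i. i \<in> I \<Longrightarrow> f i \<in> WW n l m) \<Longrightarrow> (\<Sum>i\<in>I. f i) \<in> WW n l m"
  by (induction I rule: infinite_finite_induct) (auto simp: WW_closed)

lemma ket_in_WW: "ket (a, b) \<in> WW n l m \<longleftrightarrow> a \<in> Wl_basis n l \<and> b \<in> Wl_basis n m"
  by (auto simp: WW_iff lookup_ket)

lemma hop2_linear:
  "hop2 n p r \<alpha> \<beta> (u + v) = hop2 n p r \<alpha> \<beta> u + hop2 n p r \<alpha> \<beta> v"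
  "hop2 n p r \<alpha> \<beta> (u - v) = hop2 n p r \<alpha> \<beta> u - hop2 n p r \<alpha> \<beta> v"
  "hop2 n p r \<alpha> \<beta> (smul c v) = smul c (hop2 n p r \<alpha> \<beta> v)"
  "hop2 n p r \<alpha> \<beta> 0 = 0"
  by (simp_all add: hop2_def lext_add lext_diff lext_smul)

lemma cartan_linear:
  "cartan n p r (u + v) = cartan n p r u + cartan n p r v"
  "cartan n p r (u - v) = cartan n p r u - cartan n p r v"
  "cartan n p r (smul c v) = smul c (cartan n p r v)"
  "cartan n p r 0 = 0"
  by (simp_all add: cartan_def lext_add lext_diff lext_smul)

lemma site_q_nonzero [simp]: "site_q n p \<noteq> 0"
  by (simp add: site_q_def)

lemma weight_nonzero [simp]: "weight n p r a \<noteq> 0"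
  by (simp add: weight_def)

lemma weight_empty: "a ! p = 0 \<Longrightarrow> a ! r = 0 \<Longrightarrow> weight n p r a = 1"
  by (simp add: weight_def)

section \<open>Intertwiners of the finite subalgebra\<close>

definition bar_intertwiner :: "nat \<Rightarrow> nat \<Rightarrow> nat \<Rightarrow>
    ((nat list \<times> nat list \<Rightarrow>\<^sub>0 scal) \<Rightarrow> (nat list \<times> nat list \<Rightarrow>\<^sub>0 scal)) \<Rightarrow> bool" where
  "bar_intertwiner n l m T \<longleftrightarrow>
     linear_between (WW n l m) (WW n m l) T \<and>
     (\<forall>p < n - 1. \<forall>t \<in> WW n l m.
        T (raise n p t) = raise n p (T t) \<and> T (lower n p t) = lower n p (T t) \<and>
        T (cartan n p (Suc p) t) = cartan n p (Suc p) (T t))"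

lemma length_eps: "n \<ge> 1 \<Longrightarrow> length (eps n) = n"
  by (simp add: eps_def)

text \<open>
  The cosets enter only through this: a generator lies in its own class, so the hypotheses on
  all representatives of all classes specialise to the generators.
\<close>

lemma zero_in_rel_ideal: "0 \<in> rel_ideal \<epsilon>"
proof -
  have "0 \<in> I" if "ideal I (free_alg (length \<epsilon>))" for I
    using additive_subgroup.zero_closed[OF ideal.axioms(1)[OF that]] by (simp add: free_alg_def)
  then show ?thesis by (auto simp: rel_ideal_def genideal_def)
qed

lemma in_U_A_class: "a \<in> U_A_class \<epsilon> a"
  using zero_in_rel_ideal[of \<epsilon>]
  by (force simp: U_A_class_def a_r_coset_def r_coset_def free_alg_def)

lemma gen_elem_in_U_A:
  assumes "g \<in> gens {..<length \<epsilon>}"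
  shows "U_A_class \<epsilon> (gen_elem g) \<in> carrier (U_A \<epsilon>)"
proof -
  have "supp (gen_elem g) \<subseteq> {w. set (letters w) \<subseteq> gens {..<length \<epsilon>}}"
    using assms by (auto simp: gen_elem_def ket_def)
  then show ?thesis
    by (auto simp: U_A_def U_A_class_def FactRing_def A_RCOSETS_def' free_alg_def span_of_def)
qed

lemma gen_elem_in_U_A_bar:
  assumes "g \<in> gens {1..<length \<epsilon>}"
  shows "U_A_class \<epsilon> (gen_elem g) \<in> U_A_bar \<epsilon>"
  unfolding U_A_bar_def using assms by (intro generate_ring.incl) auto

lemma scrP_bar_intertwiner:
  assumes "n \<ge> 2" "is_scrP n l m s P"
  shows "bar_intertwiner n l m P"
proof -
  have lin: "linear_between (WW n l m) (WW n m l) P"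
    using assms(2) by (simp add: is_scrP_def)
  have *: "rep2 n ypar xpar (coprod (gen_elem g)) (P t) = P (rep2 n xpar ypar (coprod (gen_elem g)) t)"
    if "g \<in> gens {1..<n}" "t \<in> WW n l m" for g t
    using assms that gen_elem_in_U_A_bar[of g "eps n"] in_U_A_class[of "gen_elem g" "eps n"]
    by (auto simp: is_scrP_def length_eps)
  have **: "GE (Suc p) \<in> gens {1..<n} \<and> GF (Suc p) \<in> gens {1..<n} \<and> GK (Suc p) \<in> gens {1..<n}"
    if "p < n - 1" for p using that by (auto simp: gens_def)
  show ?thesis
    unfolding bar_intertwiner_def
  proof (intro conjI lin allI impI ballI)
    fix p t assume "p < n - 1" "t \<in> WW n l m"
    moreover from this have "P t \<in> WW n m l" using lin by (simp add: linear_between_def)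
    ultimately show "P (raise n p t) = raise n p (P t)" "P (lower n p t) = lower n p (P t)"
      "P (cartan n p (Suc p) t) = cartan n p (Suc p) (P t)"
      using *[of "GE (Suc p)" t] *[of "GF (Suc p)" t] *[of "GK (Suc p)" t] **[of p] assms(1)
      by (simp_all add: rep2_finite WW_supp)
  qed
qed

lemma flip_in_WW: "v \<in> WW n l m \<Longrightarrow> flip v \<in> WW n m l"
  unfolding WW_iff lookup_flip by blast

lemma flip_add: "flip (u + v) = flip u + flip v" and flip_smul: "flip (smul c v) = smul c (flip v)"
  by (simp_all add: flip_def lext_add lext_smul)

lemma flip_R:
  assumes "n \<ge> 2" "is_quantum_R n l m R"
  shows "bar_intertwiner n l m (\<lambda>t. flip (R t))"
    and "t \<in> WW n l m \<Longrightarrow> flip (R (affine_raise n xpar ypar t)) = affine_raise n ypar xpar (flip (R t))"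
    and "t \<in> WW n l m \<Longrightarrow> flip (R (affine_lower n xpar ypar t)) = affine_lower n ypar xpar (flip (R t))"
proof -
  have R: "linear_between (WW n l m) (WW n l m) R"
    using assms(2) by (simp add: is_quantum_R_def)
  then have lin: "linear_between (WW n l m) (WW n m l) (\<lambda>t. flip (R t))"
    by (simp add: linear_between_def flip_add flip_smul flip_in_WW)
  have *: "rep2 n ypar xpar (coprod (gen_elem g)) (flip (R t)) = flip (R (rep2 n xpar ypar (coprod (gen_elem g)) t))"
    if "g \<in> gens {..<n}" "t \<in> WW n l m" for g t
  proof -
    have "rep2 n xpar ypar (coprod_op (gen_elem g)) (R t) = R (rep2 n xpar ypar (coprod (gen_elem g)) t)"
      using assms that gen_elem_in_U_A[of g "eps n"] in_U_A_class[of "gen_elem g" "eps n"]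
      by (auto simp: is_quantum_R_def length_eps)
    then show ?thesis by (simp add: coprod_op_def flip: flip_rep2)
  qed
  have **: "GE (Suc p) \<in> gens {..<n} \<and> GF (Suc p) \<in> gens {..<n} \<and> GK (Suc p) \<in> gens {..<n}"
    if "p < n - 1" for p using that by (auto simp: gens_def)
  have ***: "GE 0 \<in> gens {..<n} \<and> GF 0 \<in> gens {..<n}" using assms(1) by (auto simp: gens_def)
  have mem: "flip (R t) \<in> WW n m l" if "t \<in> WW n l m" for t
    using lin that by (simp add: linear_between_def)
  show "bar_intertwiner n l m (\<lambda>t. flip (R t))"
    unfolding bar_intertwiner_def
  proof (intro conjI lin allI impI ballI)
    fix p t assume "p < n - 1" "t \<in> WW n l m"
    then show "flip (R (raise n p t)) = raise n p (flip (R t))"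
      "flip (R (lower n p t)) = lower n p (flip (R t))"
      "flip (R (cartan n p (Suc p) t)) = cartan n p (Suc p) (flip (R t))"
      using *[of "GE (Suc p)" t] *[of "GF (Suc p)" t] *[of "GK (Suc p)" t] **[of p] assms(1) mem[of t]
      by (simp_all add: rep2_finite WW_supp)
  qed
  show "t \<in> WW n l m \<Longrightarrow> flip (R (affine_raise n xpar ypar t)) = affine_raise n ypar xpar (flip (R t))"
    "t \<in> WW n l m \<Longrightarrow> flip (R (affine_lower n xpar ypar t)) = affine_lower n ypar xpar (flip (R t))"
    using *[of "GE 0" t] *[of "GF 0" t] *** assms(1) mem[of t]
    by (simp_all add: rep2_affine WW_supp)
qed

section \<open>Weight vectors\<close>

text \<open>
  The sites are numbered from 0, so the fermionic ones are \<open>{..<n - 1}\<close>.  A set \<open>C\<close> of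
  fermionic sites encodes the weight in which the two factors together have one fermion on each
  site of \<open>C\<close> and none elsewhere.
\<close>

definition occupancy :: "nat \<Rightarrow> nat \<Rightarrow> nat \<Rightarrow> nat set \<Rightarrow> (nat list \<times> nat list) set" where
  "occupancy n l m C = {(a, b). a \<in> Wl_basis n l \<and> b \<in> Wl_basis n m \<and>
     (\<forall>p < n - 1. a ! p + b ! p = (if p \<in> C then 1 else 0))}"

abbreviation fermions :: "nat \<Rightarrow> nat list \<Rightarrow> nat" where
  "fermions n a \<equiv> (\<Sum>p<n - 1. a ! p)"

primrec inversions :: "nat \<Rightarrow> nat list \<Rightarrow> nat list \<Rightarrow> nat" where
  "inversions 0 a b = 0"
| "inversions (Suc N) a b = inversions N a b + (\<Sum>p<N. a ! p) * b ! N"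

text \<open>
  The coefficient depends on the position of the fermions through their relative order only.
  The same formula therefore serves for every \<open>C\<close>, not just for the final segments that occur in
  \<open>\<xi>\<^sub>s\<close>, and lowering operators act on the vectors \<open>hwv n l m C\<close> by moving \<open>C\<close>.
\<close>

definition hw_coef :: "nat \<Rightarrow> nat \<Rightarrow> nat \<Rightarrow> nat list \<Rightarrow> nat list \<Rightarrow> scal" where
  "hw_coef n m s a b =
     (- 1) ^ fermions n b * qpar ^ (fermions n b * (m - s + 1) + inversions (n - 1) a b)"

definition hwv :: "nat \<Rightarrow> nat \<Rightarrow> nat \<Rightarrow> nat set \<Rightarrow> (nat list \<times> nat list \<Rightarrow>\<^sub>0 scal)" where
  "hwv n l m C =
     (\<Sum>k \<in> occupancy n l m C. smul (hw_coef n m (card C) (fst k) (snd k)) (ket k))"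

lemma finite_Wl_basis: "finite (Wl_basis n l)"
proof (rule finite_subset)
  show "Wl_basis n l \<subseteq> {xs. set xs \<subseteq> {..l} \<and> length xs = n}"
    by (auto simp: Wl_basis_def W_basis_def intro: member_le_sum_list)
qed (rule finite_lists_length_eq, simp)

lemma occupancy_Times: "occupancy n l m C \<subseteq> Wl_basis n l \<times> Wl_basis n m"
  by (auto simp: occupancy_def)

lemma finite_occupancy: "finite (occupancy n l m C)"
  by (rule finite_subset[OF occupancy_Times]) (simp add: finite_Wl_basis)

lemma occupancy_sym: "(a, b) \<in> occupancy n l m C \<longleftrightarrow> (b, a) \<in> occupancy n m l C"
  by (auto simp: occupancy_def add.commute)

lemma coord_hwv:
  "coord (hwv n l m C) (a, b) = (if (a, b) \<in> occupancy n l m C then hw_coef n m (card C) a b else 0)"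
  by (simp add: hwv_def lookup_sum lookup_ket if_distrib sum.delta' finite_occupancy cong: if_cong)

lemma hwv_in_WW: "hwv n l m C \<in> WW n l m"
  unfolding WW_iff coord_hwv using occupancy_Times[of n l m C] by (auto split: if_splits)

lemma hw_coef_nonzero [simp]: "hw_coef n m s a b \<noteq> 0"
  by (simp add: hw_coef_def)

lemma Wl_basis_length: "a \<in> Wl_basis n l \<Longrightarrow> length a = n"
  by (simp add: Wl_basis_def W_basis_def)

lemma Wl_basis_le_1: "a \<in> Wl_basis n l \<Longrightarrow> p < n - 1 \<Longrightarrow> a ! p \<le> 1"
  by (auto simp: Wl_basis_def W_basis_def le_Suc_eq)

lemma Wl_basis_total:
  assumes "n \<ge> 1" "a \<in> Wl_basis n l"
  shows "fermions n a + a ! (n - 1) = l"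
proof -
  have "l = (\<Sum>p<n. a ! p)"
    using assms by (auto simp: Wl_basis_def W_basis_def sum_list_sum_nth atLeast0LessThan)
  also have "{..<n} = insert (n - 1) {..<n - 1}" using assms by auto
  finally show ?thesis by simp
qed

lemma occupancy_card:
  assumes "(a, b) \<in> occupancy n l m C" "C \<subseteq> {..<n - 1}"
  shows "fermions n a + fermions n b = card C"
proof -
  have "fermions n a + fermions n b = (\<Sum>p<n - 1. if p \<in> C then 1 else 0)"
    using assms(1) by (simp add: occupancy_def flip: sum.distrib)
  also have "\<dots> = card C" using assms(2) by (simp add: sum.If_cases Int_absorb1)
  finally show ?thesis .
qed

lemma Wl_basis_moveI:
  assumes "a \<in> Wl_basis n l" "p \<noteq> r" "p < n" "r < n" "a ! p \<ge> 1" "r = n - 1 \<or> a ! r = 0"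
  shows "move p r a \<in> Wl_basis n l"
proof -
  have "length a = n" "\<And>i. i < n - 1 \<Longrightarrow> a ! i \<in> {0, 1}" "sum_list a = l"
    using assms(1) by (auto simp: Wl_basis_def W_basis_def)
  moreover from this(2) have "a ! p - 1 \<in> {0, 1}" if "p < n - 1" using that by fastforce
  ultimately show ?thesis
    using assms(2-) by (auto simp: Wl_basis_def W_basis_def nth_move sum_list_move)
qed

lemma move_in_Wl_basis_iff:
  assumes "a \<in> W_basis n" "p \<noteq> r" "p < n" "r < n" "a ! p \<ge> 1" "move p r a \<in> Wl_basis n l"
  shows "a \<in> Wl_basis n l"
  using assms sum_list_move[of p r a] by (simp add: Wl_basis_def W_basis_def)

definition vac :: "nat \<Rightarrow> nat \<Rightarrow> nat list" where
  "vac n l = replicate (n - 1) 0 @ [l]"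

lemma length_vac [simp]: "n \<ge> 1 \<Longrightarrow> length (vac n l) = n"
  by (simp add: vac_def)

lemma nth_vac: "p < n - 1 \<Longrightarrow> vac n l ! p = 0" "vac n l ! (n - Suc 0) = l"
  by (simp_all add: vac_def nth_append)

lemma vac_in_Wl_basis: "n \<ge> 1 \<Longrightarrow> vac n l \<in> Wl_basis n l"
  by (auto simp: Wl_basis_def W_basis_def vac_def nth_append sum_list_replicate)

lemma eq_vac:
  assumes "n \<ge> 1" "a \<in> Wl_basis n l" "\<And>p. p < n - 1 \<Longrightarrow> a ! p = 0"
  shows "a = vac n l"
proof (rule nth_equalityI)
  show "length a = length (vac n l)" using assms by (simp add: Wl_basis_length)
  fix i assume "i < length a"
  moreover have "a ! (n - 1) = l" using Wl_basis_total[OF assms(1,2)] assms(3) by simp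
  ultimately show "a ! i = vac n l ! i"
    using assms by (cases "i = n - 1") (auto simp: nth_vac Wl_basis_length)
qed

text \<open>The second factor of the one basis vector of weight \<open>C\<close> whose first factor is \<open>|l e\<^sub>n\<rangle>\<close>.\<close>

definition fill :: "nat \<Rightarrow> nat \<Rightarrow> nat set \<Rightarrow> nat list" where
  "fill n m C = map (\<lambda>p. if p \<in> C then 1 else 0) [0..<n - 1] @ [m - card C]"

lemma nth_fill: "p < n - 1 \<Longrightarrow> fill n m C ! p = (if p \<in> C then 1 else 0)"
  by (simp add: fill_def nth_append)

lemma fill_in_occupancy:
  assumes "n \<ge> 1" "C \<subseteq> {..<n - 1}" "card C \<le> m"
  shows "(vac n l, fill n m C) \<in> occupancy n l m C"
proof -
  have "sum_list (map (\<lambda>p. if p \<in> C then 1 else 0) [0..<n - 1]) = card C"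
    using assms(2) by (simp add: interv_sum_list_conv_sum_set_nat sum.If_cases Int_absorb1 atLeast0LessThan)
  then have "sum_list (fill n m C) = m" using assms by (simp add: fill_def)
  moreover have "length (fill n m C) = n" using assms by (simp add: fill_def)
  ultimately have "fill n m C \<in> Wl_basis n m" by (auto simp: Wl_basis_def W_basis_def nth_fill)
  then show ?thesis
    using assms(1) by (auto simp: occupancy_def vac_in_Wl_basis nth_vac nth_fill)
qed

lemma occupancy_vac:
  assumes "n \<ge> 1" "(vac n l, b) \<in> occupancy n l m C" "C \<subseteq> {..<n - 1}"
  shows "b = fill n m C"
proof (rule nth_equalityI)
  have b: "b \<in> Wl_basis n m" "\<And>p. p < n - 1 \<Longrightarrow> b ! p = (if p \<in> C then 1 else 0)"
    using assms(2) by (auto simp: occupancy_def nth_vac)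
  have "fermions n (vac n l) = 0" by (simp add: nth_vac)
  then have "b ! (n - 1) = m - card C"
    using occupancy_card[OF assms(2,3)] Wl_basis_total[OF assms(1) b(1)] by simp
  moreover show "length b = length (fill n m C)" using b assms(1) by (simp add: fill_def Wl_basis_length)
  moreover fix i assume "i < length b"
  ultimately show "b ! i = fill n m C ! i"
    using b(2)[of i] assms(1) by (cases "i = n - 1") (auto simp: fill_def nth_append)
qed

text \<open>
  The potential driving all inductions: \<open>lower n p\<close> increases it by one and \<open>raise n p\<close>
  decreases it by one.
\<close>

definition deficit :: "nat \<Rightarrow> nat list \<Rightarrow> nat" where
  "deficit n a = (\<Sum>p<n. (n - 1 - p) * a ! p)"

lemma sum_two:
  fixes f :: "nat \<Rightarrow> nat"
  assumes "Suc p < n"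
  shows "(\<Sum>i<n. f i) = f p + f (Suc p) + (\<Sum>i\<in>{..<n} - {p, Suc p}. f i)"
proof -
  have "{..<n} = insert p (insert (Suc p) ({..<n} - {p, Suc p}))" using assms by auto
  then have "(\<Sum>i<n. f i) = (\<Sum>i\<in>insert p (insert (Suc p) ({..<n} - {p, Suc p})). f i)" by simp
  then show ?thesis by (simp add: add.assoc)
qed

lemma deficit_move:
  assumes "length a = n" "Suc p < n" "a ! p \<ge> 1"
  shows "Suc (deficit n (move p (Suc p) a)) = deficit n a"
proof -
  let ?a = "move p (Suc p) a"
  have "(\<Sum>i\<in>{..<n} - {p, Suc p}. (n - 1 - i) * ?a ! i) = (\<Sum>i\<in>{..<n} - {p, Suc p}. (n - 1 - i) * a ! i)"
    using assms by (intro sum.cong) (auto simp: nth_move)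
  moreover obtain k where k: "a ! p = Suc k" using assms(3) by (cases "a ! p") auto
  moreover have "n - 1 - p = Suc (n - 1 - Suc p)" using assms(2) by simp
  moreover have "?a ! p = k" "?a ! Suc p = Suc (a ! Suc p)" using assms k by (simp_all add: nth_move)
  ultimately show ?thesis
    unfolding deficit_def sum_two[OF assms(2)] by (simp only: k mult_Suc mult_Suc_right add_Suc add_Suc_right add_ac)
qed

lemma fermions_cong:
  assumes "Suc p < n - 1" "\<And>i. i \<noteq> p \<Longrightarrow> i \<noteq> Suc p \<Longrightarrow> i < n - 1 \<Longrightarrow> a ! i = b ! i"
    "a ! p + a ! Suc p = b ! p + b ! Suc p"
  shows "fermions n a = fermions n b"
proof -
  have "(\<Sum>i\<in>{..<n - 1} - {p, Suc p}. a ! i) = (\<Sum>i\<in>{..<n - 1} - {p, Suc p}. b ! i)"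
    using assms(2) by (intro sum.cong) auto
  then show ?thesis unfolding sum_two[OF assms(1)] using assms(3) by simp
qed

lemma inversions_cong:
  assumes "\<And>i. i < N \<Longrightarrow> a ! i = a' ! i" "\<And>i. i < N \<Longrightarrow> b ! i = b' ! i"
  shows "inversions N a b = inversions N a' b'"
  using assms
proof (induction N)
  case (Suc N)
  have "(\<Sum>p<N. a ! p) = (\<Sum>p<N. a' ! p)" using Suc.prems by (intro sum.cong) auto
  then show ?case using Suc by simp
qed simp

text \<open>
  Changing two adjacent sites without changing the number of fermions that the first factor has
  on them affects only the inversions that end at one of these sites.
\<close>

lemma inversions_local:
  assumes "Suc (Suc p) \<le> N" "a ! p + a ! Suc p = a' ! p + a' ! Suc p"
    and "\<And>i. i \<noteq> p \<Longrightarrow> i \<noteq> Suc p \<Longrightarrow> i < N \<Longrightarrow> a ! i = a' ! i \<and> b ! i = b' ! i"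
  shows "inversions N a b + (a' ! p * b' ! Suc p + (\<Sum>i<p. a ! i) * (b' ! p + b' ! Suc p)) =
    inversions N a' b' + (a ! p * b ! Suc p + (\<Sum>i<p. a ! i) * (b ! p + b ! Suc p))"
  using assms
proof (induction N rule: dec_induct)
  case base
  have "inversions p a b = inversions p a' b'" using base by (intro inversions_cong) auto
  moreover have "(\<Sum>i<p. a ! i) = (\<Sum>i<p. a' ! i)" using base by (intro sum.cong) auto
  ultimately show ?case by (simp add: algebra_simps)
next
  case (step N)
  have "(\<Sum>i<N. a ! i) = (\<Sum>i<N. a' ! i)"
  proof -
    have p: "Suc p < N" using step by simp
    have "(\<Sum>i\<in>{..<N} - {p, Suc p}. a ! i) = (\<Sum>i\<in>{..<N} - {p, Suc p}. a' ! i)"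
      using step.prems(2) by (intro sum.cong) auto
    then show ?thesis unfolding sum_two[OF p] using step.prems(1) by simp
  qed
  moreover have "b ! N = b' ! N" using step by auto
  ultimately show ?case using step.IH step.prems by (simp add: algebra_simps)
qed

text \<open>
  The last fermion can always hop one site to the right.  This undoes a lowering operator, which is
  why every basis vector can be reached from \<open>|l e\<^sub>n\<rangle>\<close>.
\<close>

lemma fermionic_step:
  assumes "a \<in> Wl_basis n l" "n \<ge> 1" "a \<noteq> vac n l"
  obtains p where "p < n - 1" "a ! p = 1" "Suc p = n - 1 \<or> a ! Suc p = 0"
proof -
  let ?S = "{p. p < n - 1 \<and> a ! p = 1}"
  have S: "a ! p = 0 \<or> p \<in> ?S" if "p < n - 1" for p
    using Wl_basis_le_1[OF assms(1) that] that by (auto simp: le_Suc_eq)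
  have "?S \<noteq> {}" using eq_vac[OF assms(2,1)] assms(3) S by blast
  have "finite ?S" by simp
  define q where "q = Max ?S"
  have M: "q \<in> ?S" "\<And>p. p \<in> ?S \<Longrightarrow> p \<le> q"
    unfolding q_def using \<open>?S \<noteq> {}\<close> \<open>finite ?S\<close> by (rule Max_in[rotated]) (rule Max_ge, simp)
  show ?thesis
  proof (rule that[of q])
    show "q < n - 1" "a ! q = 1" using M(1) by auto
    show "Suc q = n - 1 \<or> a ! Suc q = 0"
    proof (cases "Suc q = n - 1")
      case False
      then have "Suc q < n - 1" using M(1) by simp
      then have "a ! Suc q = 0 \<or> Suc q \<in> ?S" by (rule S)
      then show ?thesis
      proof
        assume "Suc q \<in> ?S"
        then have "Suc q \<le> q" by (rule M(2))
        then show ?thesis by simp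
      qed simp
    qed simp
  qed
qed

text \<open>
  The equations \<open>raise n p w = 0\<close> express the coefficient of \<open>|a\<rangle> \<otimes> |b\<rangle>\<close> through those of
  vectors whose first factor has a smaller deficit, hence through the \<open>|l e\<^sub>n\<rangle> \<otimes> |b\<rangle>\<close>.
\<close>

lemma raise_kernel:
  assumes n: "n \<ge> 2" and w: "w \<in> WW n l m"
    and killed: "\<And>p. p < n - 1 \<Longrightarrow> raise n p w = 0"
    and vac: "\<And>b. coord w (vac n l, b) = 0"
  shows "w = 0"
proof -
  have "coord w (a, b) = 0" for a b
  proof (induction "deficit n a" arbitrary: a b rule: less_induct)
    case less
    show ?case
    proof (rule ccontr)
      assume *: "coord w (a, b) \<noteq> 0"
      with w have a: "a \<in> Wl_basis n l" and b: "b \<in> Wl_basis n m" by (auto simp: WW_iff)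
      moreover have "a \<noteq> vac n l" using * vac by auto
      ultimately obtain p where p: "p < n - 1" "a ! p = 1" "Suc p = n - 1 \<or> a ! Suc p = 0"
        using fermionic_step[of a n l] n by auto
      let ?a = "move p (Suc p) a"
      have a': "?a \<in> Wl_basis n l" using a p by (intro Wl_basis_moveI) auto
      have len: "length a = n" using a by (rule Wl_basis_length)
      have "deficit n ?a < deficit n a" using deficit_move[OF len, of p] p by linarith
      then have IH: "coord w (?a, b') = 0" for b' using less by blast
      have "?a ! p = 0" "?a ! Suc p \<ge> 1" "move (Suc p) p ?a = a"
        using p len by (auto simp: nth_move move_move)
      moreover have "?a \<in> W_basis n" using a' by (simp add: Wl_basis_def)
      moreover have "coord (raise n p w) (?a, b) = 0" using killed p by simp
      ultimately have "weight n p (Suc p) b * coord w (a, b) = 0"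
        using p by (simp add: raise_def coord_hop2 WW_supp[OF w] IH cong: if_cong)
      with * show False by simp
    qed
  qed
  then show ?thesis by (intro poly_mapping_eqI) auto
qed

text \<open>
  For a final segment \<open>C\<close> of the fermionic sites, both coefficients entering \<open>raise n p\<close> vanish
  or are nonzero simultaneously; the converse direction follows by exchanging the factors.
\<close>

lemma occupancy_exchange:
  assumes n: "n \<ge> 2" and C: "C \<subseteq> {..<n - 1}" "\<forall>p\<in>C. Suc p < n - 1 \<longrightarrow> Suc p \<in> C"
    and m: "card C \<le> m" and p: "p < n - 1"
    and a: "a \<in> W_basis n" "a ! Suc p \<ge> 1" and ab: "(move (Suc p) p a, b) \<in> occupancy n l m C"
  shows "b \<in> W_basis n" "b ! Suc p \<ge> 1" "(a, move (Suc p) p b) \<in> occupancy n l m C"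
    "a ! p = 0" "b ! p = 0" "Suc p < n - 1 \<Longrightarrow> a ! Suc p = 1 \<and> b ! Suc p = 1"
proof -
  have len: "length a = n" using a by (simp add: W_basis_def)
  have b: "b \<in> Wl_basis n m" and a': "move (Suc p) p a \<in> Wl_basis n l"
    and sum: "\<And>i. i < n - 1 \<Longrightarrow> move (Suc p) p a ! i + b ! i = (if i \<in> C then 1 else 0)"
    using ab by (auto simp: occupancy_def)
  have lenb: "length b = n" using b by (rule Wl_basis_length)
  have al: "a \<in> Wl_basis n l" using move_in_Wl_basis_iff[OF a(1) _ _ _ a(2) a'] p by simp
  show "b \<in> W_basis n" using b by (simp add: Wl_basis_def)
  have pC: "p \<in> C" and ap: "a ! p = 0" and bp: "b ! p = 0"
    using sum[of p] p len by (auto simp: nth_move split: if_splits)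
  show "a ! p = 0" "b ! p = 0" by fact+
  have nxt: "a ! Suc p = 1 \<and> b ! Suc p = 1" if "Suc p < n - 1"
    using sum[of "Suc p"] that C(2)[rule_format, OF pC that] len a(2) Wl_basis_le_1[OF al that] p
    by (auto simp: nth_move)
  then show "Suc p < n - 1 \<Longrightarrow> a ! Suc p = 1 \<and> b ! Suc p = 1" .
  show bS: "b ! Suc p \<ge> 1"
  proof (cases "Suc p < n - 1")
    case False
    then have S: "Suc p = n - 1" using p by simp
    have "move (Suc p) p a ! p = 1" using len p ap by (simp add: nth_move)
    moreover have "move (Suc p) p a ! p \<le> fermions n (move (Suc p) p a)"
      using p by (intro member_le_sum) auto
    ultimately have "fermions n b < card C" using occupancy_card[OF ab C(1)] by simp
    then show ?thesis using Wl_basis_total[OF _ b] n m S by simp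
  qed (use nxt in simp)
  show "(a, move (Suc p) p b) \<in> occupancy n l m C"
    unfolding occupancy_def
  proof (clarify, intro conjI allI impI)
    show "move (Suc p) p b \<in> Wl_basis n m" using b bS bp p by (intro Wl_basis_moveI) auto
    show "a \<in> Wl_basis n l" by fact
    fix i assume i: "i < n - 1"
    show "a ! i + move (Suc p) p b ! i = (if i \<in> C then 1 else 0)"
      proof -
      consider "i = p" | "i = Suc p" | "i \<noteq> p" "i \<noteq> Suc p" by blast
      then show ?thesis
      proof cases
        case 1
        then show ?thesis using p lenb ap bp pC by (simp add: nth_move)
      next
        case 2
        then show ?thesis using nxt C(2) pC i lenb p by (simp add: nth_move)
      next
        case 3
        then show ?thesis using sum[OF i] p len lenb by (simp add: nth_move)
      qed
    qed
  qed
qed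

text \<open>
  Between two fermionic sites the weight contributes \<open>-1/q\<close>, which cancels the additional inversion.
  At the bosonic site it contributes a power of \<open>q\<close> with exponent the number of bosons in the second
  factor; it cancels the growth of \<open>q\<^sup>j\<^sup>(\<^sup>m\<^sup>-\<^sup>s\<^sup>+\<^sup>1\<^sup>)\<close> together with the new inversions with the
  fermions of the first factor.
\<close>

lemma hw_coef_exchange:
  assumes n: "n \<ge> 2" and C: "C \<subseteq> {..<n - 1}" "\<forall>p\<in>C. Suc p < n - 1 \<longrightarrow> Suc p \<in> C"
    and m: "card C \<le> m" and p: "p < n - 1"
    and a: "a \<in> W_basis n" "a ! Suc p \<ge> 1" and ab: "(move (Suc p) p a, b) \<in> occupancy n l m C"
  shows "weight n p (Suc p) b * hw_coef n m (card C) (move (Suc p) p a) b +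
    hw_coef n m (card C) a (move (Suc p) p b) = 0"
proof -
  note facts = occupancy_exchange[OF n C m p a ab]
  let ?a = "move (Suc p) p a" and ?b = "move (Suc p) p b"
  have len: "length a = n" "length b = n" using a facts(1) by (auto simp: W_basis_def)
  have b: "b \<in> Wl_basis n m" using ab by (simp add: occupancy_def)
  show ?thesis
  proof (cases "Suc p < n - 1")
    case True
    note one = facts(6)[OF True]
    have "fermions n ?b = fermions n b"
      using True len one facts(5) by (intro fermions_cong[of p]) (auto simp: nth_move)
    moreover have "inversions (n - 1) ?a b = Suc (inversions (n - 1) a ?b)"
      using inversions_local[of p "n - 1" ?a a b ?b] True len one facts(4,5) by (auto simp: nth_move)
    moreover have "weight n p (Suc p) b = - inverse qpar"
      using True one facts(5) by (simp add: weight_def site_q_def)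
    ultimately show ?thesis by (simp add: hw_coef_def power_add)
  next
    case False
    then have S: "Suc p = n - 1" using p by simp
    have sums: "(\<Sum>i<p. ?a ! i) = (\<Sum>i<p. a ! i)" "(\<Sum>i<p. ?b ! i) = (\<Sum>i<p. b ! i)"
      using len p by (auto intro!: sum.cong simp: nth_move)
    have fb: "fermions n ?b = Suc (fermions n b)"
      using S[symmetric] sums len facts(5) p by (simp add: nth_move)
    have fa: "fermions n ?a = Suc (fermions n a)"
      using S[symmetric] sums len facts(4) p by (simp add: nth_move)
    have "inversions p ?a b = inversions p a ?b"
      using len p by (intro inversions_cong) (auto simp: nth_move)
    then have inv: "inversions (n - 1) a ?b = inversions (n - 1) ?a b + fermions n a"
      using S[symmetric] len facts(4,5) p by (simp add: nth_move)
    have "weight n p (Suc p) b = qpar ^ (b ! (n - 1))"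
      using S facts(5) by (simp add: weight_def site_q_def)
    moreover have "b ! (n - 1) = (m - card C + 1) + fermions n a"
      using Wl_basis_total[OF _ b] occupancy_card[OF ab C(1)] fa n m by simp
    ultimately show ?thesis
      unfolding hw_coef_def fb inv by (simp add: power_add algebra_simps)
  qed
qed

lemma raise_hwv:
  assumes n: "n \<ge> 2" and C: "C \<subseteq> {..<n - 1}" "\<forall>p\<in>C. Suc p < n - 1 \<longrightarrow> Suc p \<in> C"
    and lm: "card C \<le> l" "card C \<le> m" and p: "p < n - 1"
  shows "raise n p (hwv n l m C) = 0"
proof (rule poly_mapping_eqI)
  fix k :: "nat list \<times> nat list"
  obtain a b where k: "k = (a, b)" by force
  let ?A = "a \<in> W_basis n \<and> a ! Suc p \<ge> 1 \<and> (move (Suc p) p a, b) \<in> occupancy n l m C"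
  let ?B = "b \<in> W_basis n \<and> b ! Suc p \<ge> 1 \<and> (a, move (Suc p) p b) \<in> occupancy n l m C"
  have AB: ?B if ?A
    using occupancy_exchange[OF n C lm(2) p, of a b l] that by simp
  have BA: ?A if ?B
    using occupancy_exchange[OF n C lm(1) p, of b a m] that
    by (simp add: occupancy_sym[of "move (Suc p) p b"] occupancy_sym[of b])
  from AB BA have "?A \<longleftrightarrow> ?B" by (rule iffI)
  moreover have "coord (raise n p (hwv n l m C)) (a, b) =
      (if ?A then qint (a ! p + 1) * weight n p (Suc p) b * hw_coef n m (card C) (move (Suc p) p a) b else 0) +
      (if ?B then qint (b ! p + 1) * hw_coef n m (card C) a (move (Suc p) p b) else 0)"
    using p by (simp add: raise_def coord_hop2 WW_supp[OF hwv_in_WW] coord_hwv)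
  moreover have "a ! p = 0" "b ! p = 0" if ?A
    using occupancy_exchange(4,5)[OF n C lm(2) p, of a b l] that by simp_all
  moreover have "weight n p (Suc p) b * hw_coef n m (card C) (move (Suc p) p a) b +
    hw_coef n m (card C) a (move (Suc p) p b) = 0" if ?A
    using hw_coef_exchange[OF n C lm(2) p, of a b l] that by simp
  ultimately show "coord (raise n p (hwv n l m C)) k = coord 0 k"
    unfolding k by (cases ?A) auto
qed

section \<open>The vectors \<open>\<xi>\<^sub>s\<close> in coordinates\<close>

definition segment :: "nat \<Rightarrow> nat \<Rightarrow> nat set" where
  "segment n s = {n - 1 - s..<n - 1}"

lemma boxtimes_sum_right: "u \<boxtimes> (\<Sum>i\<in>I. f i) = (\<Sum>i\<in>I. u \<boxtimes> f i)"
proof -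
  have "u \<boxtimes> (v + w) = (u \<boxtimes> v) + (u \<boxtimes> w)" for v w
    unfolding boxtimes_def lext_fun_add[symmetric]
    by (rule lext_cong) (auto simp: lext_add)
  moreover have "u \<boxtimes> 0 = 0" by (simp add: boxtimes_def lext_def case_prod_unfold)
  ultimately show ?thesis by (induction I rule: infinite_finite_induct) auto
qed

lemma boxtimes_smul_right: "u \<boxtimes> smul c v = smul c (u \<boxtimes> v)"
  by (simp add: boxtimes_def lext_smul lext_def[of _ u] case_prod_unfold smul_sum mult.commute)

lemma boxtimes_sum_left: "(\<Sum>i\<in>I. f i) \<boxtimes> u = (\<Sum>i\<in>I. f i \<boxtimes> u)"
  by (simp add: boxtimes_def lext_sum)

lemma boxtimes_smul_left: "smul c v \<boxtimes> u = smul c (v \<boxtimes> u)"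
  by (simp add: boxtimes_def lext_smul)

lemma boxtimes_ket: "ket (a, b) \<boxtimes> ket (a', b') = ket (a @ a', b @ b')"
  by (simp add: boxtimes_def)

lemma sum_prefix_zeros: "(\<Sum>p<z + s. (replicate z 0 @ a) ! p) = (\<Sum>p<s. (a ! p :: nat))"
proof (induction s)
  case 0
  then show ?case by (simp add: nth_append)
qed (simp add: nth_append)

lemma inversions_zeros: "inversions (z + s) (replicate z 0 @ a) (replicate z 0 @ b) = inversions s a b"
proof (induction s)
  case 0
  have "inversions N (replicate z 0 @ a) (replicate z 0 @ b) = 0" if "N \<le> z" for N
    using that by (induction N) (auto simp: nth_append)
  then show ?case by simp
next
  case (Suc s)
  have "(replicate z 0 @ b) ! (z + s) = b ! s" by (simp add: nth_append)
  with Suc show ?case by (simp add: sum_prefix_zeros)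
qed

lemma inversions_sum:
  "inversions r a b = (\<Sum>(s, t) \<in> {(s, t). s < t \<and> t < r}. a ! s * b ! t)"
proof (induction r)
  case (Suc r)
  have eq: "{(s, t). s < t \<and> t < Suc r} = {(s, t). s < t \<and> t < r} \<union> (\<lambda>s. (s, r)) ` {..<r}"
    by auto
  have fin: "finite {(s, t). s < t \<and> t < r}"
    by (rule finite_subset[of _ "{..<r} \<times> {..<r}"]) auto
  have "(\<Sum>(s, t) \<in> (\<lambda>s. (s, r)) ` {..<r}. a ! s * b ! t) = (\<Sum>s<r. a ! s) * b ! r"
    by (subst sum.reindex) (auto simp: inj_on_def sum_distrib_right)
  moreover have "{(s, t). s < t \<and> t < r} \<inter> (\<lambda>s. (s, r)) ` {..<r} = {}" by auto
  ultimately show ?case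
    unfolding eq using Suc fin by (simp add: sum.union_disjoint)
qed simp

definition bits :: "nat \<Rightarrow> nat list set" where
  "bits s = {i. length i = s \<and> set i \<subseteq> {0, 1}}"

lemma finite_bits: "finite (bits s)"
  by (rule finite_subset[OF _ finite_lists_length_eq[of "{0, 1::nat}" s]]) (auto simp: bits_def)

lemma bits_nth: "i \<in> bits s \<Longrightarrow> p < s \<Longrightarrow> i ! p = 0 \<or> i ! p = 1"
proof -
  assume "i \<in> bits s" "p < s"
  then have "i ! p \<in> set i" "set i \<subseteq> {0, 1}" by (simp_all add: bits_def)
  then show "i ! p = 0 \<or> i ! p = 1" by blast
qed

lemma bits_complement: "i \<in> bits s \<Longrightarrow> sum_list (map (\<lambda>c. 1 - c) i) = s - sum_list i \<and> sum_list i \<le> s"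
proof (induction s arbitrary: i)
  case (Suc s)
  then obtain x i' where i: "i = x # i'" "i' \<in> bits s" "x = 0 \<or> x = 1"
    by (cases i) (auto simp: bits_def)
  then show ?case using Suc.IH[OF i(2)] by (elim disjE conjE) simp_all
qed (simp add: bits_def)

text \<open>
  A basis vector in the support of \<open>\<xi>\<^sub>s\<close> is given by the distribution of its \<open>s\<close> fermions
  over the two factors.
\<close>

definition pair_of_bits :: "nat \<Rightarrow> nat \<Rightarrow> nat \<Rightarrow> nat \<Rightarrow> nat list \<Rightarrow> nat list \<times> nat list" where
  "pair_of_bits n l m s i =
     (replicate (n - s - 1) 0 @ i @ [l - sum_list i],
      replicate (n - s - 1) 0 @ map (\<lambda>c. 1 - c) i @ [m - (s - sum_list i)])"

lemma bij_pair_of_bits: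
  assumes "s \<le> n - 1" "n \<ge> 1" "s \<le> l" "s \<le> m"
  shows "bij_betw (pair_of_bits n l m s) (bits s) (occupancy n l m (segment n s))"
proof (rule bij_betw_imageI)
  show "inj_on (pair_of_bits n l m s) (bits s)"
    by (auto simp: inj_on_def pair_of_bits_def bits_def)
  show "pair_of_bits n l m s ` bits s = occupancy n l m (segment n s)"
  proof (intro equalityI subsetI)
    fix k assume "k \<in> pair_of_bits n l m s ` bits s"
    then obtain i where i: "i \<in> bits s" and k: "k = pair_of_bits n l m s i" by auto
    have len: "length i = s" using i by (simp add: bits_def)
    show "k \<in> occupancy n l m (segment n s)"
      unfolding k pair_of_bits_def occupancy_def
    proof (clarify, intro conjI allI impI)
      show "replicate (n - s - 1) 0 @ i @ [l - sum_list i] \<in> Wl_basis n l"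
        using assms len bits_nth[OF i] bits_complement[OF i]
        by (auto simp: Wl_basis_def W_basis_def nth_append sum_list_replicate)
      show "replicate (n - s - 1) 0 @ map (\<lambda>c. 1 - c) i @ [m - (s - sum_list i)] \<in> Wl_basis n m"
        using assms len bits_nth[OF i] bits_complement[OF i]
        by (auto simp: Wl_basis_def W_basis_def nth_append sum_list_replicate)
      fix p assume p: "p < n - 1"
      show "(replicate (n - s - 1) 0 @ i @ [l - sum_list i]) ! p +
        (replicate (n - s - 1) 0 @ map (\<lambda>c. 1 - c) i @ [m - (s - sum_list i)]) ! p =
        (if p \<in> segment n s then 1 else 0)"
      proof (cases "p < n - s - 1")
        case False
        then have "p - (n - s - 1) < s" using p assms by linarith
        then show ?thesis
          using False assms len p bits_nth[OF i, of "p - (n - s - 1)"]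
          by (auto simp: nth_append segment_def)
      qed (use assms in \<open>auto simp: nth_append segment_def\<close>)
    qed
  next
    fix k assume k: "k \<in> occupancy n l m (segment n s)"
    obtain a b where ab: "k = (a, b)" by force
    define i where "i = map (\<lambda>p. a ! (n - 1 - s + p)) [0..<s]"
    have a: "a \<in> Wl_basis n l" and b: "b \<in> Wl_basis n m"
      and sum: "\<And>p. p < n - 1 \<Longrightarrow> a ! p + b ! p = (if p \<in> segment n s then 1 else 0)"
      using k ab by (auto simp: occupancy_def)
    have len: "length a = n" "length b = n" using a b by (simp_all add: Wl_basis_length)
    have "a ! (n - 1 - s + p) \<in> {0, 1}" if "p < s" for p
      using Wl_basis_le_1[OF a, of "n - 1 - s + p"] that assms(1) by (auto simp: le_Suc_eq)
    then have i: "i \<in> bits s" unfolding bits_def i_def by fastforce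
    have fa: "fermions n a = sum_list i"
    proof -
      have "a ! p = 0" if "p < n - 1" "p \<notin> segment n s" for p
        using sum[OF that(1)] that(2) by simp
      then have "fermions n a = (\<Sum>p\<in>segment n s. a ! p)"
        by (intro sum.mono_neutral_right) (auto simp: segment_def)
      also have "\<dots> = (\<Sum>p<s. a ! (n - 1 - s + p))"
        using assms(1) unfolding segment_def
        by (intro sum.reindex_bij_witness[of _ "\<lambda>p. n - 1 - s + p" "\<lambda>p. p - (n - 1 - s)"]) auto
      finally show ?thesis by (simp add: i_def interv_sum_list_conv_sum_set_nat atLeast0LessThan)
    qed
    have card: "card (segment n s) = s" using assms by (simp add: segment_def)
    have fb: "fermions n b = s - sum_list i"
    proof -
      have "segment n s \<subseteq> {..<n - 1}" by (auto simp: segment_def)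
      then have "fermions n a + fermions n b = s"
        using occupancy_card[of a b n l m "segment n s"] k ab card by simp
      then show ?thesis using fa by simp
    qed
    have "a = fst (pair_of_bits n l m s i)"
    proof (rule nth_equalityI)
      show "length a = length (fst (pair_of_bits n l m s i))"
        using assms len by (simp add: pair_of_bits_def i_def)
      fix p assume "p < length a"
      then consider "p < n - 1 - s" | "n - 1 - s \<le> p" "p < n - 1" | "p = n - 1" using len by linarith
      then show "a ! p = fst (pair_of_bits n l m s i) ! p"
      proof cases
        case 1
        then show ?thesis using sum[of p] by (simp add: pair_of_bits_def nth_append segment_def)
      next
        case 2
        then have "p - (n - s - 1) < s" "n - 1 - s + (p - (n - s - 1)) = p" using assms by linarith+
        then show ?thesis using 2 assms by (simp add: pair_of_bits_def nth_append i_def)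
      next
        case 3
        have "a ! (n - 1) = l - sum_list i" using assms Wl_basis_total[OF _ a] fa by simp
        moreover have "n - 1 = length (replicate (n - s - 1) (0::nat) @ i)"
          using assms by (simp add: i_def)
        ultimately show ?thesis
          unfolding 3 pair_of_bits_def fst_conv append_assoc[symmetric] by (metis nth_append_length)
      qed
    qed
    moreover have "b = snd (pair_of_bits n l m s i)"
    proof (rule nth_equalityI)
      show "length b = length (snd (pair_of_bits n l m s i))"
        using assms len by (simp add: pair_of_bits_def i_def)
      fix p assume "p < length b"
      then consider "p < n - 1 - s" | "n - 1 - s \<le> p" "p < n - 1" | "p = n - 1" using len by linarith
      then show "b ! p = snd (pair_of_bits n l m s i) ! p"
      proof cases
        case 1
        then show ?thesis using sum[of p] by (simp add: pair_of_bits_def nth_append segment_def)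
      next
        case 2
        then have "p - (n - s - 1) < s" "n - 1 - s + (p - (n - s - 1)) = p" using assms by linarith+
        then show ?thesis using 2 assms sum[of p]
          by (simp add: pair_of_bits_def nth_append i_def segment_def)
      next
        case 3
        have "b ! (n - 1) = m - (s - sum_list i)" using assms Wl_basis_total[OF _ b] fb by simp
        moreover have "n - 1 = length (replicate (n - s - 1) (0::nat) @ map (\<lambda>c. 1 - c) i)"
          using assms by (simp add: i_def)
        ultimately show ?thesis
          unfolding 3 pair_of_bits_def snd_conv append_assoc[symmetric] by (metis nth_append_length)
      qed
    qed
    ultimately show "k \<in> pair_of_bits n l m s ` bits s" using i ab by auto
  qed
qed

lemma hw_coef_bits:
  assumes "s \<le> n - 1" "n \<ge> 1" "i \<in> bits s"
  shows "hw_coef n m s (fst (pair_of_bits n l m s i)) (snd (pair_of_bits n l m s i)) =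
    (- 1) ^ (s - sum_list i) * qpar ^ ((s - sum_list i) * (m - s + 1)) *
    qpar ^ (\<Sum>(s, t) \<in> {(s, t). s < t \<and> t < length i}. i ! s * (1 - i ! t))"
proof -
  have len: "length i = s" using assms by (simp add: bits_def)
  have n: "n - 1 = (n - s - 1) + s" using assms by simp
  have "fermions n (snd (pair_of_bits n l m s i)) = (\<Sum>p<s. (map (\<lambda>c. 1 - c) i @ [m - (s - sum_list i)]) ! p)"
    unfolding n pair_of_bits_def snd_conv by (rule sum_prefix_zeros)
  also have "\<dots> = (\<Sum>p<s. (map (\<lambda>c. 1 - c) i) ! p)"
    using len by (intro sum.cong) (auto simp: nth_append)
  also have "\<dots> = sum_list (map (\<lambda>c. 1 - c) i)"
    using len by (simp add: sum_list_sum_nth atLeast0LessThan)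
  also have "\<dots> = s - sum_list i" using bits_complement[OF assms(3)] by simp
  finally have f: "fermions n (snd (pair_of_bits n l m s i)) = s - sum_list i" .
  have "inversions (n - 1) (fst (pair_of_bits n l m s i)) (snd (pair_of_bits n l m s i)) =
      inversions s (i @ [l - sum_list i]) (map (\<lambda>c. 1 - c) i @ [m - (s - sum_list i)])"
    unfolding n pair_of_bits_def fst_conv snd_conv by (rule inversions_zeros)
  also have "\<dots> = inversions s i (map (\<lambda>c. 1 - c) i)"
    using len by (intro inversions_cong) (auto simp: nth_append)
  also have "\<dots> = (\<Sum>(s, t) \<in> {(s, t). s < t \<and> t < length i}. i ! s * (1 - i ! t))"
    unfolding inversions_sum len by (rule sum.cong) (auto simp: len)
  finally show ?thesis
    unfolding hw_coef_def f by (simp add: power_add)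
qed

lemma xi_eq_hwv:
  assumes "n \<ge> 1" "s \<le> n - 1" "s \<le> l" "s \<le> m"
  shows "xi n l m s = hwv n l m (segment n s)"
proof -
  let ?inv = "\<lambda>i. \<Sum>(s, t) \<in> {(s, t). s < t \<and> t < length i}. i ! s * (1 - i ! t)"
  let ?I = "\<lambda>j. {i. length i = s \<and> set i \<subseteq> {0, 1} \<and> sum_list i = j}"
  let ?pad = "replicate (n - s - 1) (0::nat)"
  have card: "card (segment n s) = s" using assms by (simp add: segment_def)
  have "xi n l m s = (\<Sum>j = 0..s. \<Sum>i\<in>?I (s - j).
      smul ((- 1) ^ j * qpar ^ (j * (m - s + 1)) * qpar ^ ?inv i)
        (ket (?pad @ i @ [l + j - s], ?pad @ map (\<lambda>c. 1 - c) i @ [m - j])))"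
    unfolding xi_def J_vec_def
    by (simp add: boxtimes_sum_right boxtimes_smul_right boxtimes_sum_left boxtimes_smul_left
        boxtimes_ket smul_sum)
  also have "\<dots> = (\<Sum>j = 0..s. \<Sum>i\<in>?I (s - j).
      smul (hw_coef n m s (fst (pair_of_bits n l m s i)) (snd (pair_of_bits n l m s i)))
        (ket (pair_of_bits n l m s i)))"
  proof (intro sum.cong refl)
    fix j i assume j: "j \<in> {0..s}" and i: "i \<in> ?I (s - j)"
    then have b: "i \<in> bits s" and "s - sum_list i = j" "l + j - s = l - sum_list i"
      using assms by (auto simp: bits_def)
    then show "smul ((- 1) ^ j * qpar ^ (j * (m - s + 1)) * qpar ^ ?inv i)
        (ket (?pad @ i @ [l + j - s], ?pad @ map (\<lambda>c. 1 - c) i @ [m - j])) =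
      smul (hw_coef n m s (fst (pair_of_bits n l m s i)) (snd (pair_of_bits n l m s i)))
        (ket (pair_of_bits n l m s i))"
      unfolding hw_coef_bits[OF assms(2,1) b] by (simp add: pair_of_bits_def)
  qed
  also have "\<dots> = (\<Sum>i\<in>bits s.
      smul (hw_coef n m s (fst (pair_of_bits n l m s i)) (snd (pair_of_bits n l m s i)))
        (ket (pair_of_bits n l m s i)))"
  proof -
    have fin: "finite (?I j)" for j :: nat by (rule finite_subset[OF _ finite_bits[of s]]) (auto simp: bits_def)
    have un: "bits s = (\<Union>j\<in>{0..s}. ?I (s - j))"
    proof (intro equalityI subsetI)
      fix i assume i: "i \<in> bits s"
      then have "i \<in> ?I (s - (s - sum_list i))" using bits_complement[OF i] by (auto simp: bits_def)
      then show "i \<in> (\<Union>j\<in>{0..s}. ?I (s - j))" by fastforce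
    qed (auto simp: bits_def)
    show ?thesis
      unfolding un by (rule sum.UNION_disjoint[symmetric]) (use fin in auto)
  qed
  also have "\<dots> = hwv n l m (segment n s)"
    unfolding hwv_def card by (rule sum.reindex_bij_betw[OF bij_pair_of_bits]) (use assms in auto)
  finally show ?thesis .
qed

section \<open>Moving the support of a weight vector\<close>

text \<open>
  No scalar appears: the moving fermion has no other fermion on its two sites, so neither the
  weight factor nor the number of inversions changes.
\<close>

lemma lower_hwv:
  assumes n: "n \<ge> 2" and p: "Suc p < n - 1" and C: "Suc p \<in> C" "p \<notin> C" "finite C"
  shows "lower n p (hwv n l m C) = hwv n l m (insert p (C - {Suc p}))"
proof (rule poly_mapping_eqI)
  fix k :: "nat list \<times> nat list"
  obtain a b where k: "k = (a, b)" by force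
  let ?C = "insert p (C - {Suc p})"
  let ?a = "move p (Suc p) a" and ?b = "move p (Suc p) b"
  have card: "card ?C = card C"
  proof -
    have "card ?C = Suc (card (C - {Suc p}))" using C by (intro card_insert_disjoint) auto
    also have "\<dots> = card C" using C by (intro card_Suc_Diff1) auto
    finally show ?thesis .
  qed
  let ?A = "a \<in> W_basis n \<and> a ! p \<ge> 1 \<and> (?a, b) \<in> occupancy n l m C"
  let ?B = "b \<in> W_basis n \<and> b ! p \<ge> 1 \<and> (a, ?b) \<in> occupancy n l m C"
  have dir: "a ! p = 1 \<and> a ! Suc p = 0 \<and> b ! p = 0 \<and> b ! Suc p = 0 \<and> (a, b) \<in> occupancy n l m ?C"
    if a: "a \<in> W_basis n" "a ! p \<ge> 1" and ab: "(move p (Suc p) a, b) \<in> occupancy n l m C"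
    for a b l m
  proof -
    have len: "length a = n" using a by (simp add: W_basis_def)
    have al: "a \<in> Wl_basis n l" using move_in_Wl_basis_iff[of a n p "Suc p" l] a ab p
      by (auto simp: occupancy_def)
    have b: "b \<in> Wl_basis n m" using ab by (simp add: occupancy_def)
    have sum: "move p (Suc p) a ! i + b ! i = (if i \<in> C then 1 else 0)" if "i < n - 1" for i
      using ab that by (simp add: occupancy_def)
    have ap: "a ! p = 1" using Wl_basis_le_1[OF al, of p] a p by simp
    have bp: "b ! p = 0" using sum[of p] p C by simp
    have S: "a ! Suc p = 0" "b ! Suc p = 0" using sum[of "Suc p"] p C len by (simp_all add: nth_move)
    have "a ! i + b ! i = (if i \<in> ?C then 1 else 0)" if "i < n - 1" for i
    proof -
      consider "i = p" | "i = Suc p" | "i \<noteq> p" "i \<noteq> Suc p" by blast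
      then show ?thesis
      proof cases
        case 3
        then show ?thesis using sum[OF that] len p by (simp add: nth_move)
      qed (use ap bp S in simp_all)
    qed
    then show ?thesis using al b ap bp S by (simp add: occupancy_def)
  qed
  have rev: "a \<in> W_basis n \<and> a ! p \<ge> 1 \<and> (move p (Suc p) a, b) \<in> occupancy n l m C"
    if ab: "(a, b) \<in> occupancy n l m ?C" and a: "a ! p \<ge> 1" for a b l m
  proof -
    have al: "a \<in> Wl_basis n l" and b: "b \<in> Wl_basis n m"
      and sum: "\<And>i. i < n - 1 \<Longrightarrow> a ! i + b ! i = (if i \<in> ?C then 1 else 0)"
      using ab by (auto simp: occupancy_def)
    have len: "length a = n" using al by (rule Wl_basis_length)
    have S: "a ! Suc p = 0" "b ! Suc p = 0" using sum[of "Suc p"] p by simp_all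
    have ap: "a ! p = 1" "b ! p = 0" using sum[of p] p a by simp_all
    have "move p (Suc p) a \<in> Wl_basis n l" using al a S p by (intro Wl_basis_moveI) auto
    moreover have "move p (Suc p) a ! i + b ! i = (if i \<in> C then 1 else 0)" if "i < n - 1" for i
    proof -
      consider "i = p" | "i = Suc p" | "i \<noteq> p" "i \<noteq> Suc p" by blast
      then show ?thesis
      proof cases
        case 1
        then show ?thesis using ap len p C by (simp add: nth_move)
      next
        case 2
        then show ?thesis using S len p C by (simp add: nth_move)
      next
        case 3
        then show ?thesis using sum[OF that] len p by (simp add: nth_move)
      qed
    qed
    ultimately show ?thesis using al b a by (simp add: occupancy_def Wl_basis_def)
  qed
  note dirA = dir[of a b l m] and dirB = dir[of b a m l]
  have A: "?A \<longleftrightarrow> (a, b) \<in> occupancy n l m ?C \<and> a ! p \<ge> 1" using dirA rev[of a b l m] by blast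
  have B: "?B \<longleftrightarrow> (a, b) \<in> occupancy n l m ?C \<and> b ! p \<ge> 1"
    using dirB rev[of b a m l] occupancy_sym[of a ?b] occupancy_sym[of a b] by blast
  have coord: "coord (lower n p (hwv n l m C)) (a, b) =
      (if ?A then qint (a ! Suc p + 1) * hw_coef n m (card C) ?a b else 0) +
      (if ?B then qint (b ! Suc p + 1) * inverse (weight n p (Suc p) a) * hw_coef n m (card C) a ?b else 0)"
    using p by (simp add: lower_def coord_hop2 WW_supp[OF hwv_in_WW] coord_hwv)
  show "coord (lower n p (hwv n l m C)) k = coord (hwv n l m ?C) k"
  proof (cases "(a, b) \<in> occupancy n l m ?C")
    case False
    then show ?thesis unfolding k coord A B coord_hwv by simp
  next
    case True
    then have len: "length a = n" "length b = n" and "a ! p + b ! p = 1"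
      using p by (auto simp: occupancy_def Wl_basis_length)
    then consider "a ! p = 1" "b ! p = 0" | "b ! p = 1" "a ! p = 0" by linarith
    then show ?thesis
    proof cases
      case 1
      have zero: "a ! Suc p = 0" "b ! Suc p = 0" using A dirA True 1 by auto
      have "inversions (n - 1) ?a b = inversions (n - 1) a b"
        using inversions_local[of p "n - 1" ?a a b b] p len zero 1 by (simp add: nth_move)
      then show ?thesis
        unfolding k coord A B coord_hwv using True zero 1 card by (simp add: hw_coef_def)
    next
      case 2
      have zero: "a ! Suc p = 0" "b ! Suc p = 0" using B dirB True 2 occupancy_sym[of a ?b] by auto
      have "inversions (n - 1) a ?b = inversions (n - 1) a b"
        using inversions_local[of p "n - 1" a a ?b b] p len zero 2 by (simp add: nth_move)
      moreover have "fermions n ?b = fermions n b"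
        using p len zero 2 by (intro fermions_cong[of p]) (auto simp: nth_move)
      ultimately show ?thesis
        unfolding k coord A B coord_hwv using True zero 2 card
        by (simp add: hw_coef_def weight_empty)
    qed
  qed
qed

lemma inversions_first:
  assumes "\<And>i. i < N \<Longrightarrow> i \<noteq> 0 \<Longrightarrow> a' ! i = a ! i" "a ! 0 = 0" "b ! 0 = 0" "a' ! 0 = 1"
  shows "inversions N a' b = inversions N a b + (\<Sum>i<N. b ! i)"
  using assms
proof (induction N)
  case (Suc N)
  show ?case
  proof (cases N)
    case (Suc N')
    have "(\<Sum>i<N. a' ! i) = Suc (\<Sum>i<N. a ! i)"
      unfolding Suc sum.lessThan_Suc_shift using Suc.prems \<open>N = Suc N'\<close> by simp
    then show ?thesis using Suc.IH Suc.prems by (simp add: algebra_simps)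
  qed (use Suc.prems in simp)
qed simp

lemma inversions_first_right:
  assumes "\<And>i. i < N \<Longrightarrow> i \<noteq> 0 \<Longrightarrow> b' ! i = b ! i"
  shows "inversions N a b' = inversions N a b"
  using assms
proof (induction N)
  case (Suc N)
  then show ?case by (cases N) auto
qed simp

text \<open>
  The two summands come from the fermion on the first site sitting in the first or in the second
  factor.  In the first case it is inverted with all \<open>j\<close> fermions of the second factor, and these
  \<open>j\<close> inversions are what the change from \<open>s\<close> to \<open>s - 1\<close> in \<open>q\<^sup>j\<^sup>(\<^sup>m\<^sup>-\<^sup>s\<^sup>+\<^sup>1\<^sup>)\<close> requires.  In the second case the
  Cartan factor counts the bosons of the first factor.
\<close>

lemma affine_raise_hwv:
  assumes n: "n \<ge> 2" and C: "0 \<notin> C" "C \<subseteq> {..<n - 1}" and lm: "card C < l" "card C < m"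
  shows "affine_raise n x y (hwv n l m (insert 0 C)) =
    smul (inverse x - qpar ^ (l + m - 2 * card C) * inverse y) (hwv n l m C)"
proof (rule poly_mapping_eqI)
  fix k :: "nat list \<times> nat list"
  obtain a b where k: "k = (a, b)" by force
  let ?C = "insert 0 C"
  let ?a = "move (n - 1) 0 a" and ?b = "move (n - 1) 0 b"
  have finC: "finite C" using C(2) finite_subset by blast
  have card: "card ?C = Suc (card C)" using C finC by simp
  let ?A = "a \<in> W_basis n \<and> a ! (n - 1) \<ge> 1 \<and> (?a, b) \<in> occupancy n l m ?C"
  let ?B = "b \<in> W_basis n \<and> b ! (n - 1) \<ge> 1 \<and> (a, ?b) \<in> occupancy n l m ?C"
  have iff: "a \<in> W_basis n \<and> a ! (n - 1) \<ge> 1 \<and> (move (n - 1) 0 a, b) \<in> occupancy n l m ?C \<longleftrightarrow>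
    (a, b) \<in> occupancy n l m C" if "card C < l" for a b l m
  proof
    assume *: "a \<in> W_basis n \<and> a ! (n - 1) \<ge> 1 \<and> (move (n - 1) 0 a, b) \<in> occupancy n l m ?C"
    then have len: "length a = n" by (simp add: W_basis_def)
    have al: "a \<in> Wl_basis n l"
      using move_in_Wl_basis_iff[of a n "n - 1" 0 l] * n by (auto simp: occupancy_def)
    have sum: "move (n - 1) 0 a ! i + b ! i = (if i \<in> ?C then 1 else 0)" if "i < n - 1" for i
      using * that by (simp add: occupancy_def)
    have "a ! i + b ! i = (if i \<in> C then 1 else 0)" if "i < n - 1" for i
      using sum[OF that] that len n C by (cases "i = 0") (simp_all add: nth_move)
    then show "(a, b) \<in> occupancy n l m C" using al * by (simp add: occupancy_def)
  next
    assume *: "(a, b) \<in> occupancy n l m C"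
    then have al: "a \<in> Wl_basis n l" and sum: "\<And>i. i < n - 1 \<Longrightarrow> a ! i + b ! i = (if i \<in> C then 1 else 0)"
      by (auto simp: occupancy_def)
    have len: "length a = n" using al by (rule Wl_basis_length)
    have pos: "a ! (n - 1) \<ge> 1"
      using Wl_basis_total[OF _ al] occupancy_card[OF * C(2)] that n by simp
    have zero: "a ! 0 = 0" "b ! 0 = 0" using sum[of 0] C n by simp_all
    have "move (n - 1) 0 a \<in> Wl_basis n l" using al pos zero n by (intro Wl_basis_moveI) auto
    moreover have "move (n - 1) 0 a ! i + b ! i = (if i \<in> ?C then 1 else 0)" if "i < n - 1" for i
      using sum[OF that] that len n zero by (cases "i = 0") (simp_all add: nth_move)
    ultimately show "a \<in> W_basis n \<and> a ! (n - 1) \<ge> 1 \<and> (move (n - 1) 0 a, b) \<in> occupancy n l m ?C"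
      using al pos * by (simp add: occupancy_def Wl_basis_def)
  qed
  have A: "?A \<longleftrightarrow> (a, b) \<in> occupancy n l m C" by (rule iff[OF lm(1)])
  have B: "?B \<longleftrightarrow> (a, b) \<in> occupancy n l m C"
    unfolding occupancy_sym[of a] by (rule iff[OF lm(2)])
  have coord: "coord (affine_raise n x y (hwv n l m ?C)) (a, b) =
      (if ?A then qint (a ! 0 + 1) * inverse x * hw_coef n m (card ?C) ?a b else 0) +
      (if ?B then qint (b ! 0 + 1) * (inverse y * inverse (weight n (n - 1) 0 a)) * hw_coef n m (card ?C) a ?b else 0)"
    using n by (simp add: affine_raise_def coord_hop2 WW_supp[OF hwv_in_WW] coord_hwv)
  show "coord (affine_raise n x y (hwv n l m ?C)) k =
    coord (smul (inverse x - qpar ^ (l + m - 2 * card C) * inverse y) (hwv n l m C)) k"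
  proof (cases "(a, b) \<in> occupancy n l m C")
    case False
    then show ?thesis unfolding k coord A B lookup_smul coord_hwv by simp
  next
    case True
    then have al: "a \<in> Wl_basis n l" and bl: "b \<in> Wl_basis n m" by (simp_all add: occupancy_def)
    then have len: "length a = n" "length b = n" by (simp_all add: Wl_basis_length)
    have "a ! 0 + b ! 0 = 0" using True C n by (simp add: occupancy_def)
    then have zero: "a ! 0 = 0" "b ! 0 = 0" by simp_all
    let ?j = "fermions n b" and ?s = "card C"
    have inv_a: "inversions (n - 1) ?a b = inversions (n - 1) a b + ?j"
      using n len zero by (intro inversions_first) (auto simp: nth_move)
    have inv_b: "inversions (n - 1) a ?b = inversions (n - 1) a b"
      using n len by (intro inversions_first_right) (auto simp: nth_move)
    obtain N where N: "n - 1 = Suc N" using n by (cases "n - 1") auto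
    have fb: "fermions n ?b = Suc ?j"
    proof -
      have "(\<Sum>p<N. ?b ! Suc p) = (\<Sum>p<N. b ! Suc p)"
        using len n N by (intro sum.cong) (auto simp: nth_move)
      then show ?thesis unfolding N sum.lessThan_Suc_shift using len n N zero by (simp add: nth_move)
    qed
    have w: "inverse (weight n (n - 1) 0 a) = qpar ^ (a ! (n - 1))"
      using zero n by (simp add: weight_def site_q_def power_int_minus)
    have exps: "m - ?s = Suc (m - Suc ?s)"
      "a ! (n - 1) + m - ?s = l + m - 2 * ?s + ?j"
      using lm Wl_basis_total[OF _ al] n occupancy_card[OF True C(2)] by auto
    let ?q = "(- 1) ^ ?j * qpar ^ (?j * (m - ?s + 1) + inversions (n - 1) a b)"
    have 1: "hw_coef n m (card ?C) ?a b = ?q"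
      unfolding hw_coef_def card inv_a exps(1) by (simp add: algebra_simps)
    have e: "a ! (n - 1) + (Suc ?j * (m - Suc ?s + 1) + inversions (n - 1) a b) =
      (l + m - 2 * ?s) + (?j * (m - ?s + 1) + inversions (n - 1) a b)"
    proof -
      have "a ! (n - 1) + (m - ?s) = l + m - 2 * ?s + ?j" using exps(2) lm by simp
      then show ?thesis unfolding exps(1) by (simp add: algebra_simps)
    qed
    have 2: "qpar ^ (a ! (n - 1)) * hw_coef n m (card ?C) a ?b = - (qpar ^ (l + m - 2 * ?s) * ?q)"
    proof -
      have "qpar ^ (a ! (n - 1)) * hw_coef n m (card ?C) a ?b =
        - ((- 1) ^ ?j * qpar ^ (a ! (n - 1) + (Suc ?j * (m - Suc ?s + 1) + inversions (n - 1) a b)))"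
        unfolding hw_coef_def card fb inv_b by (simp add: power_add)
      then show ?thesis unfolding e by (simp add: power_add)
    qed
    have "coord (affine_raise n x y (hwv n l m ?C)) (a, b) =
      inverse x * hw_coef n m (card ?C) ?a b +
      inverse y * (qpar ^ (a ! (n - 1)) * hw_coef n m (card ?C) a ?b)"
      unfolding coord A B w using True zero by simp
    also have "\<dots> = (inverse x - qpar ^ (l + m - 2 * ?s) * inverse y) * ?q"
      unfolding 1 2 by (simp add: algebra_simps)
    finally show ?thesis unfolding k lookup_smul coord_hwv using True by (simp add: hw_coef_def)
  qed
qed

section \<open>Highest weight vectors generate\<close>

lemma bar_intertwiner_linear:
  assumes "bar_intertwiner n l m T"
  shows "u \<in> WW n l m \<Longrightarrow> T u \<in> WW n m l"
    and "u \<in> WW n l m \<Longrightarrow> v \<in> WW n l m \<Longrightarrow> T (u + v) = T u + T v"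
    and "u \<in> WW n l m \<Longrightarrow> T (smul c u) = smul c (T u)"
    and "T 0 = 0"
proof -
  show "u \<in> WW n l m \<Longrightarrow> T u \<in> WW n m l"
    and "u \<in> WW n l m \<Longrightarrow> v \<in> WW n l m \<Longrightarrow> T (u + v) = T u + T v"
    and smul: "u \<in> WW n l m \<Longrightarrow> T (smul c u) = smul c (T u)" for u v c
    using assms by (auto simp: bar_intertwiner_def linear_between_def)
  show "T 0 = 0" using smul[of 0 0] WW_closed(1) by simp
qed

lemma bar_intertwiner_sum:
  assumes "bar_intertwiner n l m T" "finite A" "A \<subseteq> Wl_basis n l \<times> Wl_basis n m"
  shows "T (\<Sum>k\<in>A. smul (c k) (ket k)) = (\<Sum>k\<in>A. smul (c k) (T (ket k)))"
  using assms(2,3)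
proof (induction A rule: finite_induct)
  case (insert k A)
  have ket: "ket j \<in> WW n l m" if "j \<in> insert k A" for j
    using that insert.prems by (cases j) (auto simp: ket_in_WW)
  have *: "smul (c j) (ket j) \<in> WW n l m" if "j \<in> insert k A" for j
    using ket[OF that] by (rule WW_closed)
  have "(\<Sum>k\<in>A. smul (c k) (ket k)) \<in> WW n l m" using * by (intro WW_sum) auto
  then show ?case
    using insert * ket bar_intertwiner_linear[OF assms(1)] by simp
qed (simp add: bar_intertwiner_linear[OF assms(1)])

text \<open>
  The conditions \<open>b ! Suc p \<ge> 1\<close> ensure that every vector on the right lies in \<open>\<W>\<^sub>l \<otimes> \<W>\<^sub>m\<close>, where an
  intertwiner is known to be linear; otherwise the truncated subtraction in \<open>move\<close> would change the
  total number of particles, although its coefficient vanishes.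
\<close>

lemma lower_ket:
  assumes "a \<in> Wl_basis n l" "b \<in> Wl_basis n m" "p < n - 1"
  shows "lower n p (ket (a, b)) =
    smul (qint (a ! Suc p)) (if a ! p = 0 \<and> a ! Suc p \<ge> 1 then ket (move (Suc p) p a, b) else 0) +
    smul (inverse (weight n p (Suc p) a) * qint (b ! Suc p))
      (if b ! p = 0 \<and> b ! Suc p \<ge> 1 then ket (a, move (Suc p) p b) else 0)"
proof -
  have "hop n (Suc p) p a = smul (qint (a ! Suc p))
      (if a ! p = 0 \<and> a ! Suc p \<ge> 1 then ket (move (Suc p) p a) else 0)"
    if a: "a \<in> Wl_basis n l" for a l
  proof (cases "a ! p = 0 \<and> a ! Suc p \<ge> 1")
    case True
    then have "move (Suc p) p a \<in> Wl_basis n l" using assms(3) a by (intro Wl_basis_moveI) auto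
    with True show ?thesis by (simp add: hop_def W_ket_def Wl_basis_def)
  next
    case False
    show ?thesis
    proof (cases "a ! Suc p = 0")
      case False
      with \<open>\<not> (a ! p = 0 \<and> a ! Suc p \<ge> 1)\<close> have "a ! p = 1"
        using Wl_basis_le_1[OF a, of p] assms(3) by simp
      then have "move (Suc p) p a ! p = 2"
        using Wl_basis_length[OF a] assms(3) by (simp add: nth_move)
      then have "move (Suc p) p a \<notin> W_basis n" using assms(3) by (force simp: W_basis_def)
      with \<open>a ! p = 1\<close> show ?thesis by (simp add: hop_def W_ket_def)
    qed (simp add: hop_def)
  qed
  note hop = this[OF assms(1)] this[OF assms(2)]
  show ?thesis
    unfolding lower_def hop2_def lext_ket prod.case hop tens_smul_left tens_smul_right smul_smul
    by simp
qed

text \<open>The only way in which the intertwining property enters the generation argument.\<close>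

lemma lower_relation:
  assumes T: "bar_intertwiner n l m T" and ab: "a \<in> Wl_basis n l" "b \<in> Wl_basis n m"
    and p: "p < n - 1" and zero: "T (ket (a, b)) = 0"
  shows "smul (qint (a ! Suc p))
      (if a ! p = 0 \<and> a ! Suc p \<ge> 1 then T (ket (move (Suc p) p a, b)) else 0) +
    smul (inverse (weight n p (Suc p) a) * qint (b ! Suc p))
      (if b ! p = 0 \<and> b ! Suc p \<ge> 1 then T (ket (a, move (Suc p) p b)) else 0) = 0"
proof -
  let ?u = "if a ! p = 0 \<and> a ! Suc p \<ge> 1 then ket (move (Suc p) p a, b) else 0"
  let ?v = "if b ! p = 0 \<and> b ! Suc p \<ge> 1 then ket (a, move (Suc p) p b) else 0"
  note lin = bar_intertwiner_linear[OF T]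
  have "?u \<in> WW n l m" "?v \<in> WW n l m"
    using ab p by (auto simp: ket_in_WW WW_closed intro!: Wl_basis_moveI)
  then have "T (lower n p (ket (a, b))) = smul (qint (a ! Suc p)) (T ?u) +
      smul (inverse (weight n p (Suc p) a) * qint (b ! Suc p)) (T ?v)"
    unfolding lower_ket[OF ab p] by (simp add: lin WW_closed)
  moreover have "T (lower n p (ket (a, b))) = lower n p (T (ket (a, b)))"
    using T p ab by (simp add: bar_intertwiner_def ket_in_WW)
  ultimately show ?thesis
    using zero lin(4) by (simp add: if_distrib[of T] lower_def hop2_linear cong: if_cong)
qed

definition kills_deficit :: "nat \<Rightarrow> nat \<Rightarrow> nat \<Rightarrow>
    ((nat list \<times> nat list \<Rightarrow>\<^sub>0 scal) \<Rightarrow> (nat list \<times> nat list \<Rightarrow>\<^sub>0 scal)) \<Rightarrow> nat \<Rightarrow> bool" where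
  "kills_deficit n l m T D \<longleftrightarrow>
     (\<forall>a \<in> Wl_basis n l. \<forall>b \<in> Wl_basis n m. deficit n a + deficit n b = D \<longrightarrow> T (ket (a, b)) = 0)"

lemma deficit_move_back:
  assumes "length a = n" "Suc p < n" "a ! Suc p \<ge> 1"
  shows "deficit n (move (Suc p) p a) = Suc (deficit n a)"
  using deficit_move[of "move (Suc p) p a" n p] assms by (simp add: nth_move move_move)

text \<open>Modulo vectors of smaller deficit, the lowering operators push all fermions of the first
  factor into the second one.\<close>

lemma kills_deficit_from_vac:
  assumes n: "n \<ge> 2" and T: "bar_intertwiner n l m T"
    and prev: "\<And>D'. Suc D' = D \<Longrightarrow> kills_deficit n l m T D'"
    and vac: "\<And>b. b \<in> Wl_basis n m \<Longrightarrow> deficit n b = D \<Longrightarrow> T (ket (vac n l, b)) = 0"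
  shows "kills_deficit n l m T D"
proof -
  have "T (ket (a, b)) = 0"
    if "a \<in> Wl_basis n l" "b \<in> Wl_basis n m" "deficit n a + deficit n b = D" for a b
    using that
  proof (induction "deficit n a" arbitrary: a b rule: less_induct)
    case less
    show ?case
    proof (cases "a = vac n l")
      case True
      have "deficit n (vac n l) = 0"
        unfolding deficit_def by (rule sum.neutral) (auto simp: vac_def nth_append)
      then show ?thesis using vac less.prems True by simp
    next
      case False
      then obtain p where p: "p < n - 1" "a ! p = 1" "Suc p = n - 1 \<or> a ! Suc p = 0"
        using fermionic_step[OF less.prems(1)] n by auto
      let ?a = "move p (Suc p) a"
      have len: "length a = n" "length b = n" using less.prems by (auto intro: Wl_basis_length)
      have a': "?a \<in> Wl_basis n l" using less.prems p by (intro Wl_basis_moveI) auto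
      have d: "Suc (deficit n ?a) = deficit n a" using len p by (intro deficit_move) auto
      have moved: "?a ! p = 0" "?a ! Suc p \<ge> 1" "move (Suc p) p ?a = a"
        using p len by (auto simp: nth_move move_move)
      have zero: "T (ket (?a, b)) = 0"
        using prev[of "deficit n ?a + deficit n b"] d less.prems a' by (auto simp: kills_deficit_def)
      have 1: "T (ket (?a, move (Suc p) p b)) = 0" if "b ! p = 0" "b ! Suc p \<ge> 1"
      proof (rule less.hyps)
        show "move (Suc p) p b \<in> Wl_basis n m" using less.prems p that by (intro Wl_basis_moveI) auto
        have "deficit n (move (Suc p) p b) = Suc (deficit n b)"
          using len p that by (intro deficit_move_back) auto
        then show "deficit n ?a + deficit n (move (Suc p) p b) = D" using d less.prems by simp
      qed (use d a' in auto)
      show ?thesis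
        using lower_relation[OF T a' less.prems(2) p(1) zero] 1 moved
        by (simp add: smul_eq_0_iff qint_nonzero split: if_splits)
    qed
  qed
  then show ?thesis by (auto simp: kills_deficit_def)
qed

text \<open>
  As \<open>|l e\<^sub>n\<rangle>\<close> is killed by \<open>f\<^sub>p\<close> between fermionic sites, such an operator just moves a fermion of
  the second factor, so \<open>|l e\<^sub>n\<rangle> \<otimes> |b\<rangle>\<close> is a lowered vector unless the fermions of \<open>b\<close> are as far to
  the right as possible.
\<close>

lemma kills_vac_unsorted:
  assumes T: "bar_intertwiner n l m T" and n: "n \<ge> 2"
    and prev: "\<And>D'. Suc D' = deficit n b \<Longrightarrow> kills_deficit n l m T D'"
    and b: "b \<in> Wl_basis n m" and p: "Suc p < n - 1" "b ! p = 1" "b ! Suc p = 0"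
  shows "T (ket (vac n l, b)) = 0"
proof -
  let ?b = "move p (Suc p) b"
  have len: "length b = n" using b by (rule Wl_basis_length)
  have b': "?b \<in> Wl_basis n m" using b p by (intro Wl_basis_moveI) auto
  have d: "Suc (deficit n ?b) = deficit n b" using len p by (intro deficit_move) auto
  have vac: "vac n l \<in> Wl_basis n l" using n by (intro vac_in_Wl_basis) auto
  have "deficit n (vac n l) = 0"
    unfolding deficit_def by (rule sum.neutral) (auto simp: vac_def nth_append)
  then have zero: "T (ket (vac n l, ?b)) = 0"
    using prev[of "deficit n ?b"] d vac b' by (auto simp: kills_deficit_def)
  have "?b ! p = 0" "?b ! Suc p \<ge> 1" "move (Suc p) p ?b = b" "vac n l ! Suc p = 0"
    using p len by (auto simp: nth_move move_move nth_vac)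
  then show ?thesis
    using lower_relation[OF T vac b' _ zero, of p] p by (simp add: smul_eq_0_iff qint_nonzero)
qed

lemma sorted_is_fill:
  assumes n: "n \<ge> 2" and b: "b \<in> Wl_basis n m"
    and sorted: "\<And>p. Suc p < n - 1 \<Longrightarrow> b ! p = 1 \<Longrightarrow> b ! Suc p = 1"
  obtains s where "s \<le> n - 1" "s \<le> m" "b = fill n m (segment n s)"
proof -
  define C where "C = {p. p < n - 1 \<and> b ! p = 1}"
  have occ: "(vac n 0, b) \<in> occupancy n 0 m C"
  proof -
    have "b ! p = (if p \<in> C then 1 else 0)" if "p < n - 1" for p
      using Wl_basis_le_1[OF b that] that by (auto simp: C_def)
    then show ?thesis using b n by (auto simp: occupancy_def vac_in_Wl_basis nth_vac)
  qed
  have C: "C \<subseteq> {..<n - 1}" by (auto simp: C_def)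
  then have fin: "finite C" using finite_subset by blast
  have up: "r \<in> C" if "p \<in> C" "p \<le> r" "r < n - 1" for p r
    using that(2,3)
  proof (induction r rule: dec_induct)
    case (step r)
    then show ?case using sorted[of r] by (auto simp: C_def)
  qed (use that in simp)
  have "C = segment n (card C)"
  proof (cases "C = {}")
    case False
    define q where "q = Min C"
    have q: "q \<in> C" using Min_in[OF fin False] by (simp add: q_def)
    have "C = {q..<n - 1}"
    proof (intro equalityI subsetI)
      fix r assume "r \<in> C"
      then show "r \<in> {q..<n - 1}" using C Min_le[OF fin] by (auto simp: q_def)
    next
      fix r assume "r \<in> {q..<n - 1}"
      then show "r \<in> C" using up[OF q, of r] by simp
    qed
    moreover have "q < n - 1" using q C by auto
    ultimately show ?thesis by (simp add: segment_def)
  qed (simp add: segment_def)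
  moreover have "b = fill n m C" using occupancy_vac[OF _ occ C] n by simp
  moreover have "card C \<le> n - 1" using card_mono[OF _ C] by simp
  moreover have "card C \<le> m"
    using occupancy_card[OF occ C] Wl_basis_total[OF _ b] n by (simp add: nth_vac)
  ultimately show ?thesis using that[of "card C"] by simp
qed

lemma deficit_occupancy:
  assumes "(a, b) \<in> occupancy n l m C" "C \<subseteq> {..<n - 1}" "n \<ge> 1"
  shows "deficit n a + deficit n b = (\<Sum>p\<in>C. n - 1 - p)"
proof -
  have "deficit n a + deficit n b = (\<Sum>p<n. (n - 1 - p) * (a ! p + b ! p))"
    by (simp add: deficit_def sum.distrib[symmetric] distrib_left)
  also have "\<dots> = (\<Sum>p<n. if p \<in> C then n - 1 - p else 0)"
  proof (rule sum.cong[OF refl])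
    fix p assume "p \<in> {..<n}"
    then consider "p < n - 1" | "p = n - 1" by fastforce
    then show "(n - 1 - p) * (a ! p + b ! p) = (if p \<in> C then n - 1 - p else 0)"
      using assms by cases (auto simp: occupancy_def)
  qed
  also have "\<dots> = (\<Sum>p\<in>C. n - 1 - p)"
    using assms(2) by (simp add: sum.If_cases) (intro sum.cong, auto)
  finally show ?thesis .
qed

definition triangle :: "nat \<Rightarrow> nat" where
  "triangle s = (\<Sum>k=1..s. k)"

lemma triangle_mono: "s \<le> s' \<Longrightarrow> triangle s \<le> triangle s'"
  unfolding triangle_def by (rule sum_mono2) auto

lemma segment_simps:
  assumes "s \<le> n - 1"
  shows "card (segment n s) = s" "segment n s \<subseteq> {..<n - 1}"
    "\<forall>p\<in>segment n s. Suc p < n - 1 \<longrightarrow> Suc p \<in> segment n s"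
    "(\<Sum>p\<in>segment n s. n - 1 - p) = triangle s"
proof -
  show "(\<Sum>p\<in>segment n s. n - 1 - p) = triangle s"
    unfolding triangle_def segment_def using assms
    by (intro sum.reindex_bij_witness[of _ "\<lambda>k. n - 1 - k" "\<lambda>p. n - 1 - p"]) auto
qed (use assms in \<open>auto simp: segment_def\<close>)

lemma deficit_fill:
  assumes "n \<ge> 1" "s \<le> n - 1" "s \<le> m"
  shows "deficit n (fill n m (segment n s)) = triangle s"
proof -
  have "deficit n (vac n 0) = 0"
    unfolding deficit_def by (rule sum.neutral) (auto simp: vac_def nth_append)
  moreover have "(vac n 0, fill n m (segment n s)) \<in> occupancy n 0 m (segment n s)"
    using assms segment_simps[OF assms(2)] by (intro fill_in_occupancy) auto
  ultimately show ?thesis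
    using deficit_occupancy[of "vac n 0" _ n 0 m "segment n s"] assms segment_simps[OF assms(2)]
    by fastforce
qed

text \<open>
  Within the weight space of \<open>\<xi>\<^sub>s\<close>, each lowering relation lets the last fermion of the first factor
  hop to the right in exchange for a fermion or boson of the second factor.  The scalars involved
  are nonzero and come from the action alone, so the factor \<open>c\<close> serves all intertwiners.
\<close>

lemma proportional_to_fill:
  assumes n: "n \<ge> 2" and s: "s \<le> n - 1" "s \<le> m" and ab: "(a, b) \<in> occupancy n l m (segment n s)"
  shows "\<exists>c. c \<noteq> 0 \<and> (\<forall>T. bar_intertwiner n l m T \<longrightarrow>
    (\<forall>D'. Suc D' = triangle s \<longrightarrow> kills_deficit n l m T D') \<longrightarrow>
    T (ket (a, b)) = smul c (T (ket (vac n l, fill n m (segment n s)))))"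
  using ab
proof (induction "deficit n a" arbitrary: a b rule: less_induct)
  case less
  note seg = segment_simps[OF s(1)]
  have al: "a \<in> Wl_basis n l" and bl: "b \<in> Wl_basis n m" using less.prems by (auto simp: occupancy_def)
  have n1: "n \<ge> 1" using n by simp
  show ?case
  proof (cases "a = vac n l")
    case True
    then have "b = fill n m (segment n s)" using occupancy_vac[OF n1 _ seg(2)] less.prems by blast
    with True show ?thesis by (intro exI[of _ 1]) auto
  next
    case False
    then obtain p where p: "p < n - 1" "a ! p = 1" "Suc p = n - 1 \<or> a ! Suc p = 0"
      using fermionic_step[OF al n1] by auto
    let ?a = "move p (Suc p) a" and ?b = "move (Suc p) p b"
    have len: "length a = n" using al by (rule Wl_basis_length)
    have a': "?a \<in> Wl_basis n l" using al p by (intro Wl_basis_moveI) auto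
    have d: "Suc (deficit n ?a) = deficit n a" using len p by (intro deficit_move) auto
    have moved: "?a ! p = 0" "?a ! Suc p \<ge> 1" "move (Suc p) p ?a = a"
      using p len by (auto simp: nth_move move_move)
    have "card (segment n s) \<le> m" using seg s by simp
    note exch = occupancy_exchange[OF n seg(2,3) this p(1), of ?a b l]
    have b: "b ! Suc p \<ge> 1" "b ! p = 0" "(?a, ?b) \<in> occupancy n l m (segment n s)"
      using exch(2,3,5) a' moved less.prems by (simp_all add: Wl_basis_def)
    obtain c where c: "c \<noteq> 0" "\<And>T. bar_intertwiner n l m T \<Longrightarrow>
        (\<And>D'. Suc D' = triangle s \<Longrightarrow> kills_deficit n l m T D') \<Longrightarrow>
        T (ket (?a, ?b)) = smul c (T (ket (vac n l, fill n m (segment n s))))"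
      using less.hyps[of ?a ?b] d b by auto
    let ?r = "inverse (weight n p (Suc p) ?a) * qint (b ! Suc p)"
    let ?c = "- (?r / qint (?a ! Suc p)) * c"
    have q: "qint (?a ! Suc p) \<noteq> 0" "qint (b ! Suc p) \<noteq> 0" using moved b by (auto intro!: qint_nonzero)
    have "T (ket (a, b)) = smul ?c (T (ket (vac n l, fill n m (segment n s))))"
      if T: "bar_intertwiner n l m T" and prev: "\<And>D'. Suc D' = triangle s \<Longrightarrow> kills_deficit n l m T D'"
      for T
    proof -
      have "deficit n a + deficit n b = triangle s"
        using deficit_occupancy[OF less.prems seg(2) n1] seg(4) by simp
      then have zero: "T (ket (?a, b)) = 0"
        using prev[of "deficit n ?a + deficit n b"] d a' bl by (auto simp: kills_deficit_def)
      have "smul (qint (?a ! Suc p)) (T (ket (a, b))) + smul ?r (T (ket (?a, ?b))) = 0"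
        using lower_relation[OF T a' bl p(1) zero] moved b by simp
      then have "smul (inverse (qint (?a ! Suc p)))
          (smul (qint (?a ! Suc p)) (T (ket (a, b))) + smul ?r (T (ket (?a, ?b)))) = 0" by simp
      then have "T (ket (a, b)) + smul (?r / qint (?a ! Suc p)) (T (ket (?a, ?b))) = 0"
        using q by (simp add: smul_add divide_inverse mult.commute)
      then have "T (ket (a, b)) = smul (- (?r / qint (?a ! Suc p))) (T (ket (?a, ?b)))"
        by (intro poly_mapping_eqI) (metis (no_types) add_eq_0_iff lookup_add lookup_smul lookup_zero mult_minus_left neg_equal_iff_equal add.commute)
      then show ?thesis using c(2)[OF T prev] by simp
    qed
    moreover have "?c \<noteq> 0" using q c by simp
    ultimately show ?thesis by blast
  qed
qed

text \<open>
  For \<open>s > l\<close> there is no \<open>\<xi>\<^sub>s\<close>.  Then all \<open>l\<close> particles of the first factor can be put on fermionic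
  sites other than the last one, so that \<open>f\<^sub>n\<^sub>-\<^sub>1\<close>, having no boson to move there, acts on the second
  factor alone.
\<close>

lemma kills_fill_large:
  assumes n: "n \<ge> 2" and s: "s \<le> n - 1" "s \<le> m" "l < s"
    and T: "bar_intertwiner n l m T"
    and prev: "\<And>D'. Suc D' = triangle s \<Longrightarrow> kills_deficit n l m T D'"
  shows "T (ket (vac n l, fill n m (segment n s))) = 0"
proof -
  note seg = segment_simps[OF s(1)]
  let ?A = "{n - 1 - s..<n - 1 - s + l}"
  let ?B = "segment n s - ?A"
  let ?p = "n - 2"
  have A: "?A \<subseteq> segment n s" using s by (auto simp: segment_def)
  then have cardB: "card ?B = s - l" by (subst card_Diff_subset) (auto simp: seg)
  have pB: "?p \<in> ?B" and pA: "?p \<notin> ?A" using s n by (auto simp: segment_def)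
  define a where "a = fill n l ?A"
  define b where "b = fill n m ?B"
  have "a \<in> Wl_basis n l"
    using fill_in_occupancy[of n ?A l 0] A seg n by (auto simp: a_def occupancy_def)
  moreover have "b \<in> Wl_basis n m"
  proof -
    have "?B \<subseteq> {..<n - 1}" "card ?B \<le> m" using cardB seg(2) s by auto
    then have "(vac n 0, b) \<in> occupancy n 0 m ?B"
      unfolding b_def using n by (intro fill_in_occupancy) auto
    then show ?thesis by (simp add: occupancy_def)
  qed
  moreover have "a ! p + b ! p = (if p \<in> segment n s then 1 else 0)" if "p < n - 1" for p
    using that A by (auto simp: a_def b_def nth_fill)
  ultimately have occ: "(a, b) \<in> occupancy n l m (segment n s)" and a: "a \<in> Wl_basis n l" and b: "b \<in> Wl_basis n m"
    by (auto simp: occupancy_def)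
  obtain c where c: "c \<noteq> 0" "T (ket (a, b)) = smul c (T (ket (vac n l, fill n m (segment n s))))"
    using proportional_to_fill[OF n s(1,2) occ] T prev by blast
  have Sp: "Suc ?p = n - 1" using n by simp
  have a0: "a ! Suc ?p = 0" using Sp n by (simp add: a_def fill_def nth_append)
  have bp: "b ! ?p = 1" using pB n by (simp add: b_def nth_fill)
  let ?b = "move ?p (Suc ?p) b"
  have len: "length b = n" using b by (rule Wl_basis_length)
  have b': "?b \<in> Wl_basis n m" using b bp n by (intro Wl_basis_moveI) auto
  have moved: "?b ! ?p = 0" "?b ! Suc ?p \<ge> 1" "move (Suc ?p) ?p ?b = b"
    using bp len n by (auto simp: nth_move move_move)
  have "Suc (deficit n ?b) = deficit n b" using len bp n by (intro deficit_move) auto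
  then have zero: "T (ket (a, ?b)) = 0"
    using prev[of "deficit n a + deficit n ?b"] deficit_occupancy[OF occ seg(2)] seg(4) n a b'
    by (auto simp: kills_deficit_def)
  have "T (ket (a, b)) = 0"
    using lower_relation[OF T a b' _ zero, of ?p] moved a0 n by (simp add: smul_eq_0_iff qint_nonzero)
  then show ?thesis using c by (simp add: smul_eq_0_iff)
qed

lemma intertwiner_on_hwv:
  assumes n: "n \<ge> 2" and s: "s \<le> n - 1" "s \<le> m"
  shows "\<exists>c. \<forall>T. bar_intertwiner n l m T \<longrightarrow>
    (\<forall>D'. Suc D' = triangle s \<longrightarrow> kills_deficit n l m T D') \<longrightarrow>
    T (hwv n l m (segment n s)) = smul c (T (ket (vac n l, fill n m (segment n s))))"
proof -
  let ?occ = "occupancy n l m (segment n s)"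
  have "\<forall>k\<in>?occ. \<exists>c. \<forall>T. bar_intertwiner n l m T \<longrightarrow>
    (\<forall>D'. Suc D' = triangle s \<longrightarrow> kills_deficit n l m T D') \<longrightarrow>
    T (ket k) = smul c (T (ket (vac n l, fill n m (segment n s))))"
    using proportional_to_fill[OF n s] by fast
  then obtain c where c: "\<And>k T. k \<in> ?occ \<Longrightarrow> bar_intertwiner n l m T \<Longrightarrow>
    (\<forall>D'. Suc D' = triangle s \<longrightarrow> kills_deficit n l m T D') \<Longrightarrow>
    T (ket k) = smul (c k) (T (ket (vac n l, fill n m (segment n s))))"
    by (auto simp: bchoice_iff)
  let ?h = "\<lambda>k. hw_coef n m (card (segment n s)) (fst k) (snd k)"
  show ?thesis
  proof (intro exI[of _ "\<Sum>k\<in>?occ. ?h k * c k"] allI impI)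
    fix T assume T: "bar_intertwiner n l m T"
      and prev: "\<forall>D'. Suc D' = triangle s \<longrightarrow> kills_deficit n l m T D'"
    have "T (hwv n l m (segment n s)) = (\<Sum>k\<in>?occ. smul (?h k) (T (ket k)))"
      unfolding hwv_def by (rule bar_intertwiner_sum[OF T finite_occupancy occupancy_Times])
    also have "\<dots> = (\<Sum>k\<in>?occ. smul (?h k * c k) (T (ket (vac n l, fill n m (segment n s)))))"
      by (rule sum.cong[OF refl], subst c[OF _ T prev]) simp_all
    finally show "T (hwv n l m (segment n s)) =
        smul (\<Sum>k\<in>?occ. ?h k * c k) (T (ket (vac n l, fill n m (segment n s))))"
      by (simp add: smul_sum_left)
  qed
qed

text \<open>
  The maps \<open>P s\<close> are there to certify that \<open>\<xi>\<^sub>s\<close> is not a combination of descendants of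
  \<open>\<xi>\<^sub>0, \<dots>, \<xi>\<^sub>s\<^sub>-\<^sub>1\<close>.  The induction runs over all intertwiners at once, because the statement for
  smaller deficits is applied to \<open>P s\<close> too.
\<close>

lemma intertwiner_eq_0:
  assumes n: "n \<ge> 2" and T: "bar_intertwiner n l m T"
    and P: "\<And>s. s \<le> n - 1 \<Longrightarrow> s \<le> l \<Longrightarrow> s \<le> m \<Longrightarrow> bar_intertwiner n l m (P s)"
      "\<And>s s'. s \<le> n - 1 \<Longrightarrow> s \<le> l \<Longrightarrow> s \<le> m \<Longrightarrow> s' < s \<Longrightarrow> P s (hwv n l m (segment n s')) = 0"
      "\<And>s. s \<le> n - 1 \<Longrightarrow> s \<le> l \<Longrightarrow> s \<le> m \<Longrightarrow> P s (hwv n l m (segment n s)) \<noteq> 0"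
    and zero: "\<And>s. s \<le> n - 1 \<Longrightarrow> s \<le> l \<Longrightarrow> s \<le> m \<Longrightarrow> T (hwv n l m (segment n s)) = 0"
    and t: "t \<in> WW n l m"
  shows "T t = 0"
proof -
  have "kills_deficit n l m T D"
    if "bar_intertwiner n l m T"
      "\<And>s. s \<le> n - 1 \<Longrightarrow> s \<le> l \<Longrightarrow> s \<le> m \<Longrightarrow> triangle s \<le> D \<Longrightarrow> T (hwv n l m (segment n s)) = 0"
    for T D
    using that
  proof (induction D arbitrary: T rule: less_induct)
    case (less D)
    note T = less.prems(1)
    have prev: "kills_deficit n l m T D'" if "Suc D' = D" for D'
      using that less.prems by (intro less.IH) auto
    show ?case
    proof (rule kills_deficit_from_vac[OF n T prev])
      fix b assume b: "b \<in> Wl_basis n m" "deficit n b = D"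
      show "T (ket (vac n l, b)) = 0"
      proof (cases "\<exists>p. Suc p < n - 1 \<and> b ! p = 1 \<and> b ! Suc p = 0")
        case True
        then show ?thesis using kills_vac_unsorted[OF T n _ b(1)] prev b(2) by blast
      next
        case False
        have "b ! Suc p = 1" if "Suc p < n - 1" "b ! p = 1" for p
          using False that Wl_basis_le_1[OF b(1) that(1)] by (metis le_Suc_eq le_zero_eq One_nat_def)
        then obtain s where s: "s \<le> n - 1" "s \<le> m" "b = fill n m (segment n s)"
          using sorted_is_fill[OF n b(1)] by blast
        then have D: "triangle s = D" using deficit_fill[of n s m] b n by simp
        show ?thesis
        proof (cases "s \<le> l")
          case True
          obtain c where c: "\<And>T. bar_intertwiner n l m T \<Longrightarrow>
              (\<And>D'. Suc D' = triangle s \<Longrightarrow> kills_deficit n l m T D') \<Longrightarrow>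
              T (hwv n l m (segment n s)) = smul c (T (ket (vac n l, b)))"
            using intertwiner_on_hwv[OF n s(1,2)] s(3) by blast
          have "kills_deficit n l m (P s) D'" if "Suc D' = D" for D'
          proof (rule less.IH)
            fix s' assume "triangle s' \<le> D'"
            then have "s' < s" using D that triangle_mono[of s s'] by (cases "s' < s") auto
            then show "P s (hwv n l m (segment n s')) = 0" using P(2) s True by blast
          qed (use that P(1) s True in auto)
          then have "P s (hwv n l m (segment n s)) = smul c (P s (ket (vac n l, b)))"
            using c[of "P s"] P(1) s True D by blast
          then have "c \<noteq> 0" using P(3)[of s] s True by auto
          moreover have "T (hwv n l m (segment n s)) = 0" using less.prems(2) s True D by blast
          ultimately show ?thesis using c[OF T] prev D by (simp add: smul_eq_0_iff)
        next
          case False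
          then show ?thesis using kills_fill_large[OF n s(1,2) _ T] prev D s(3) by simp
        qed
      qed
    qed
  qed
  then have "T (ket k) = 0" if "k \<in> supp t" for k
    using t that T zero by (cases k) (force simp: kills_deficit_def WW_def span_of_def)
  moreover have "T (\<Sum>k\<in>supp t. smul (coord t k) (ket k)) = (\<Sum>k\<in>supp t. smul (coord t k) (T (ket k)))"
    using t by (intro bar_intertwiner_sum[OF T]) (auto simp: WW_def span_of_def)
  ultimately show ?thesis by (simp flip: ket_expansion)
qed

section \<open>The eigenvalues\<close>

lemma smul_diff_left: "smul (c - d) v = smul c v - smul d v"
  by (rule poly_mapping_eqI) (simp add: lookup_minus left_diff_distrib)

lemma raise_linear:
  "raise n p (u + v) = raise n p u + raise n p v" "raise n p (u - v) = raise n p u - raise n p v"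
  "raise n p (smul c v) = smul c (raise n p v)"
  by (simp_all add: raise_def hop2_linear)

lemma lower_linear:
  "lower n p (u + v) = lower n p u + lower n p v" "lower n p (u - v) = lower n p u - lower n p v"
  "lower n p (smul c v) = smul c (lower n p v)"
  by (simp_all add: lower_def hop2_linear)

lemma affine_linear:
  "affine_raise n x y (smul c v) = smul c (affine_raise n x y v)"
  "affine_lower n x y (smul c v) = smul c (affine_lower n x y v)"
  by (simp_all add: affine_raise_def affine_lower_def hop2_linear)

text \<open>Squaring removes the sign of \<open>-1/q\<close> and leaves powers of the single generic element \<open>q\<close>.\<close>

lemma site_q_square:
  "site_q n p powi i * site_q n p powi i = qpar powi (if p = n - 1 then 2 * i else - 2 * i)"
proof -
  have "site_q n p powi i * site_q n p powi i = (site_q n p * site_q n p) powi i"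
    by (simp add: power_int_mult_distrib)
  also have "site_q n p * site_q n p = qpar powi (if p = n - 1 then 2 else - 2)"
    by (simp add: site_q_def power_int_minus power2_eq_square)
  also have "\<dots> powi i = qpar powi ((if p = n - 1 then 2 else - 2) * i)"
    by (rule power_int_mult[symmetric])
  finally show ?thesis by (simp split: if_splits)
qed

lemma weight_pair_square:
  assumes "n \<ge> 2" "p < n - 1"
  shows "(weight n p (Suc p) a * weight n p (Suc p) b)\<^sup>2 =
    qpar powi (2 * (int (a ! p + b ! p) + (if Suc p = n - 1 then 1 else - 1) * int (a ! Suc p + b ! Suc p)))"
proof -
  let ?s = "site_q n p" and ?t = "site_q n (Suc p)"
  have "weight n p (Suc p) a * weight n p (Suc p) b =
    ?s powi (- int (a ! p + b ! p)) * ?t powi int (a ! Suc p + b ! Suc p)"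
    by (simp add: weight_def power_int_add power_int_diff power_int_minus field_simps)
  then have "(weight n p (Suc p) a * weight n p (Suc p) b)\<^sup>2 =
    (?s powi (- int (a ! p + b ! p)) * ?s powi (- int (a ! p + b ! p))) *
    (?t powi int (a ! Suc p + b ! Suc p) * ?t powi int (a ! Suc p + b ! Suc p))"
    by (simp add: power2_eq_square mult_ac)
  then show ?thesis
    unfolding site_q_square using assms by (auto simp: algebra_simps simp flip: power_int_add)
qed

lemma total_occupancy:
  assumes "a \<in> Wl_basis n l" "b \<in> Wl_basis n m" "n \<ge> 1"
  shows "(\<Sum>p<n - 1. int (a ! p + b ! p)) + int (a ! (n - 1) + b ! (n - 1)) = int (l + m)"
proof -
  have "(\<Sum>p<n - 1. int (a ! p + b ! p)) = int (fermions n a + fermions n b)"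
    by (simp add: sum.distrib)
  then show ?thesis using Wl_basis_total[OF assms(3,1)] Wl_basis_total[OF assms(3,2)] by linarith
qed

text \<open>
  The Cartan elements determine the differences of neighbouring occupation numbers, and with
  the total number of particles this fixes all of them as soon as \<open>n \<ge> 3\<close>.
\<close>

lemma weights_separate:
  assumes n: "n \<ge> 3" and a: "a \<in> Wl_basis n l" "b \<in> Wl_basis n m"
    and c: "c \<in> Wl_basis n l" "d \<in> Wl_basis n m"
    and eq: "\<And>p. p < n - 1 \<Longrightarrow> weight n p (Suc p) a * weight n p (Suc p) b =
      weight n p (Suc p) c * weight n p (Suc p) d"
    and p: "p < n - 1"
  shows "a ! p + b ! p = c ! p + d ! p"
proof -
  define N M where "N p = int (a ! p + b ! p)" and "M p = int (c ! p + d ! p)" for p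
  have rel: "N p + (if Suc p = n - 1 then 1 else - 1) * N (Suc p) =
      M p + (if Suc p = n - 1 then 1 else - 1) * M (Suc p)" if "p < n - 1" for p
  proof -
    have n2: "n \<ge> 2" using n by simp
    have "2 * (N p + (if Suc p = n - 1 then 1 else - 1) * N (Suc p)) =
        2 * (M p + (if Suc p = n - 1 then 1 else - 1) * M (Suc p))"
      using arg_cong[OF eq[OF that], of "\<lambda>x. x\<^sup>2"]
      unfolding weight_pair_square[OF n2 that] qpar_powi_eq_iff N_def M_def .
    then show ?thesis by (metis mult_cancel_left zero_neq_numeral)
  qed
  have N: "N p = M p + (N 0 - M 0)" if "p < n - 1" for p
    using that
  proof (induction p)
    case (Suc p)
    then show ?case using rel[of p] by simp
  qed simp
  have last: "N (n - 1) = M (n - 1) - (N 0 - M 0)"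
  proof -
    have p: "n - 2 < n - 1" "Suc (n - 2) = n - 1" using n by simp_all
    have "N (n - 2) + N (n - 1) = M (n - 2) + M (n - 1)"
      using rel[OF p(1)] unfolding p(2) by (simp only: refl if_True mult_1)
    then show ?thesis using N[OF p(1)] by linarith
  qed
  define \<delta> where "\<delta> = N 0 - M 0"
  have "(\<Sum>p<n - 1. N p) = (\<Sum>p<n - 1. M p + \<delta>)"
    unfolding \<delta>_def by (intro sum.cong refl N) simp
  also have "\<dots> = (\<Sum>p<n - 1. M p) + int (n - 1) * \<delta>" by (simp add: sum.distrib)
  finally have "(\<Sum>p<n - 1. N p) = (\<Sum>p<n - 1. M p) + int (n - 1) * \<delta>" .
  moreover have "(\<Sum>p<n - 1. N p) + N (n - 1) = (\<Sum>p<n - 1. M p) + M (n - 1)"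
    using total_occupancy[OF a] total_occupancy[OF c] n unfolding N_def M_def by linarith
  ultimately have "(int (n - 1) - 1) * \<delta> = 0"
    using last unfolding left_diff_distrib mult_1 \<delta>_def[symmetric] by linarith
  then have "\<delta> = 0" using n by simp
  then have "N p = M p" using N[OF p] unfolding \<delta>_def by linarith
  then show ?thesis unfolding N_def M_def by (simp only: of_nat_eq_iff)
qed

lemma cartan_hwv:
  assumes n: "n \<ge> 2" and cd: "(c, d) \<in> occupancy n l m C" and C: "C \<subseteq> {..<n - 1}" and p: "p < n - 1"
  shows "cartan n p (Suc p) (hwv n l m C) =
    smul (weight n p (Suc p) c * weight n p (Suc p) d) (hwv n l m C)"
proof (rule poly_mapping_eqI)
  fix k :: "nat list \<times> nat list"
  obtain a b where k: "k = (a, b)" by force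
  have split: "weight n p (Suc p) a * weight n p (Suc p) b =
    site_q n p powi (- int (a ! p + b ! p)) * site_q n (Suc p) powi int (a ! Suc p + b ! Suc p)" for a b
    by (simp add: weight_def power_int_add power_int_diff power_int_minus field_simps)
  have "weight n p (Suc p) a * weight n p (Suc p) b = weight n p (Suc p) c * weight n p (Suc p) d"
    if ab: "(a, b) \<in> occupancy n l m C"
  proof -
    have eq: "a ! i + b ! i = c ! i + d ! i" if "i < n - 1" for i
      using ab cd that by (simp add: occupancy_def)
    have "a ! (n - 1) + b ! (n - 1) = c ! (n - 1) + d ! (n - 1)"
    proof -
      have W: "a \<in> Wl_basis n l" "b \<in> Wl_basis n m" "c \<in> Wl_basis n l" "d \<in> Wl_basis n m"
        using ab cd by (auto simp: occupancy_def)
      have n1: "n \<ge> 1" using n by simp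
      show ?thesis
        using Wl_basis_total[OF n1 W(1)] Wl_basis_total[OF n1 W(2)] Wl_basis_total[OF n1 W(3)]
          Wl_basis_total[OF n1 W(4)] occupancy_card[OF ab C] occupancy_card[OF cd C] by linarith
    qed
    then have "a ! Suc p + b ! Suc p = c ! Suc p + d ! Suc p"
      using eq[of "Suc p"] p by (cases "Suc p = n - 1") auto
    then show ?thesis unfolding split using eq[OF p] by simp
  qed
  then show "coord (cartan n p (Suc p) (hwv n l m C)) k =
    coord (smul (weight n p (Suc p) c * weight n p (Suc p) d) (hwv n l m C)) k"
    unfolding k coord_cartan lookup_smul coord_hwv by simp
qed

lemma hwv_empty:
  assumes "n \<ge> 1"
  shows "hwv n l m {} = ket (vac n l, vac n m)"
proof -
  have "occupancy n l m {} = {(vac n l, vac n m)}"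
    using eq_vac[OF assms] by (auto simp: occupancy_def vac_in_Wl_basis[OF assms] nth_vac)
  moreover have "inversions N a b = 0" if "\<And>i. i < N \<Longrightarrow> b ! i = 0" for N a b
    using that by (induction N) auto
  ultimately show ?thesis by (simp add: hwv_def hw_coef_def nth_vac)
qed

text \<open>
  For \<open>n = 2\<close> the Cartan elements are scalars on \<open>\<W>\<^sub>l \<otimes> \<W>\<^sub>m\<close>; there the two-dimensional weight
  space containing \<open>\<xi>\<^sub>1\<close> is spanned by the images of \<open>\<xi>\<^sub>0\<close> under \<open>f\<^sub>1\<close> and \<open>e\<^sub>0\<close>.
\<close>

lemma lower_vac_2:
  assumes "l \<ge> 1" "m \<ge> 1"
  shows "lower 2 0 (ket ([0, l], [0, m])) =
      smul (qint l) (ket ([1, l - 1], [0, m])) +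
      smul (inverse (qpar ^ l) * qint m) (ket ([0, l], [1, m - 1]))"
    and "affine_lower 2 x y (ket ([0, l], [0, m])) =
      smul (x * inverse (qpar ^ m) * qint l) (ket ([1, l - 1], [0, m])) +
      smul (y * qint m) (ket ([0, l], [1, m - 1]))"
  by (simp_all add: lower_def affine_lower_def hop2_def hop_def W_ket_def W_basis_def move_def
      weight_def site_q_def tens_smul_left tens_smul_right power_int_minus nth_Cons' mult.assoc)

lemma occupancy_2:
  assumes "l \<ge> 1" "m \<ge> 1"
  shows "occupancy 2 l m {0} = {([1, l - 1], [0, m]), ([0, l], [1, m - 1])}"
proof (intro equalityI subsetI)
  fix k assume "k \<in> occupancy 2 l m {0}"
  then obtain a b where k: "k = (a, b)" and ab: "(a, b) \<in> occupancy 2 l m {0}" by (cases k) auto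
  then have "length a = 2" "length b = 2" "sum_list a = l" "sum_list b = m" "a ! 0 + b ! 0 = 1"
    by (auto simp: occupancy_def Wl_basis_def W_basis_def)
  moreover from this obtain a0 a1 b0 b1 where "a = [a0, a1]" "b = [b0, b1]"
    by (auto simp: length_Suc_conv numeral_2_eq_2)
  ultimately show "k \<in> {([1, l - 1], [0, m]), ([0, l], [1, m - 1])}"
    unfolding k by (cases a0) auto
qed (use assms in \<open>auto simp: occupancy_def Wl_basis_def W_basis_def less_2_cases_iff\<close>)

text \<open>In the locale below, \<open>T\<close> is \<open>T\<close>.\<close>

locale quantum_R =
  fixes n l m :: nat and R :: "(nat list \<times> nat list \<Rightarrow>\<^sub>0 scal) \<Rightarrow> (nat list \<times> nat list \<Rightarrow>\<^sub>0 scal)"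
  assumes n: "n \<ge> 2" and R: "is_quantum_R n l m R"
begin

definition T :: "(nat list \<times> nat list \<Rightarrow>\<^sub>0 scal) \<Rightarrow> (nat list \<times> nat list \<Rightarrow>\<^sub>0 scal)" where
  "T t = flip (R t)"

lemma T_intertwiner: "bar_intertwiner n l m T"
  using flip_R(1)[OF n R] by (simp add: T_def[abs_def])

lemma T_affine:
  "t \<in> WW n l m \<Longrightarrow> T (affine_raise n xpar ypar t) = affine_raise n ypar xpar (T t)"
  "t \<in> WW n l m \<Longrightarrow> T (affine_lower n xpar ypar t) = affine_lower n ypar xpar (T t)"
  using flip_R(2,3)[OF n R] by (simp_all add: T_def)

lemmas T_linear = bar_intertwiner_linear[OF T_intertwiner]

lemma T_vacuum: "T (hwv n l m {}) = hwv n m l {}"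
  using n R by (simp add: hwv_empty T_def is_quantum_R_def vac_def)

text \<open>
  The images of both spanning vectors have the right weight, and the transition matrix is
  invertible because \<open>x \<noteq> q\<^sup>l\<^sup>+\<^sup>m y\<close>.
\<close>

lemma T_support_2:
  assumes n2: "n = 2" and lm: "l \<ge> 1" "m \<ge> 1" and ab: "(a, b) \<notin> occupancy n m l {0}"
  shows "coord (T (hwv n l m {0})) (a, b) = 0"
proof -
  have vac: "vac 2 l = [0, l]" for l by (simp add: vac_def)
  let ?k1 = "([1, l - 1], [0, m])" and ?k2 = "([0, l], [1, m - 1])"
  let ?f = "\<lambda>v. coord (T v) (a, b)"
  have occ: "occupancy 2 l m {0} = {?k1, ?k2}" by (rule occupancy_2[OF lm])
  then have W: "ket ?k1 \<in> WW n l m" "ket ?k2 \<in> WW n l m"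
    using occupancy_Times[of 2 l m "{0}"] n2 by (auto simp: ket_in_WW)
  have vacW: "ket ([0, l], [0, m]) \<in> WW n l m"
    using hwv_in_WW[of n l m "{}"] n n2 by (simp add: hwv_empty vac)
  have Tvac: "T (ket ([0, l], [0, m])) = ket ([0, m], [0, l])"
    using T_vacuum n n2 by (simp add: hwv_empty vac)
  have off: "(a, b) \<noteq> ([1, m - 1], [0, l])" "(a, b) \<noteq> ([0, m], [1, l - 1])"
    using ab n2 occupancy_2[OF lm(2,1)] by auto
  have "T (lower 2 0 (ket ([0, l], [0, m]))) = lower 2 0 (ket ([0, m], [0, l]))"
    using T_intertwiner vacW n2 Tvac by (simp add: bar_intertwiner_def)
  then have "?f (lower 2 0 (ket ([0, l], [0, m]))) = 0"
    using off by (auto simp: lower_vac_2[OF lm(2,1)] lookup_add lookup_ket)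
  then have 1: "qint l * ?f (ket ?k1) + inverse (qpar ^ l) * qint m * ?f (ket ?k2) = 0"
    using W by (simp add: lower_vac_2[OF lm] T_linear WW_closed lookup_add)
  have "T (affine_lower 2 xpar ypar (ket ([0, l], [0, m]))) = affine_lower 2 ypar xpar (ket ([0, m], [0, l]))"
    using T_affine(2)[OF vacW] n2 Tvac by simp
  then have "?f (affine_lower 2 xpar ypar (ket ([0, l], [0, m]))) = 0"
    using off by (auto simp: lower_vac_2[OF lm(2,1)] lookup_add lookup_ket)
  then have 2: "xpar * inverse (qpar ^ m) * qint l * ?f (ket ?k1) + ypar * qint m * ?f (ket ?k2) = 0"
    using W by (simp add: lower_vac_2[OF lm] T_linear WW_closed lookup_add)
  have ql: "qint l \<noteq> 0" "qint m \<noteq> 0" using lm by (auto intro!: qint_nonzero)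
  have det: "xpar - qpar ^ (l + m) * ypar \<noteq> 0" by (rule xpar_minus_power_ypar)
  have e1: "qint l * ?f (ket ?k1) = - (inverse (qpar ^ l) * (qint m * ?f (ket ?k2)))"
    using 1 by (simp add: add_eq_0_iff2 mult.assoc)
  have "xpar * inverse (qpar ^ m) * (qint l * ?f (ket ?k1)) + ypar * (qint m * ?f (ket ?k2)) = 0"
    using 2 by (simp add: mult.assoc)
  then have "(ypar - xpar * inverse (qpar ^ m) * inverse (qpar ^ l)) * (qint m * ?f (ket ?k2)) = 0"
    unfolding e1 by (simp add: algebra_simps)
  moreover have "ypar - xpar * inverse (qpar ^ m) * inverse (qpar ^ l) \<noteq> 0"
    using det by (auto simp: field_simps power_add)
  ultimately have f2: "?f (ket ?k2) = 0" using ql by simp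
  then have f1: "?f (ket ?k1) = 0" using e1 ql by simp
  have "T (hwv n l m {0}) = (\<Sum>k\<in>{?k1, ?k2}. smul (hw_coef n m (card {0::nat}) (fst k) (snd k)) (T (ket k)))"
    unfolding hwv_def n2 occ
    by (rule bar_intertwiner_sum[OF T_intertwiner[unfolded n2]]) (use W n2 in \<open>auto simp: ket_in_WW\<close>)
  then show ?thesis using f1 f2 by (simp add: lookup_add)
qed

lemma T_support:
  assumes s: "s \<le> n - 1" "s \<le> l" "s \<le> m" and nz: "coord (T (hwv n l m (segment n s))) (a, b) \<noteq> 0"
  shows "(a, b) \<in> occupancy n m l (segment n s)"
proof (cases "s = 0")
  case True
  then have "segment n s = {}" by (simp add: segment_def)
  then show ?thesis using nz T_vacuum by (simp add: coord_hwv split: if_splits)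
next
  case s0: False
  note seg = segment_simps[OF s(1)]
  show ?thesis
  proof (cases "n = 2")
    case True
    then have "segment n s = {0}" using s s0 by (auto simp: segment_def)
    then show ?thesis using T_support_2[of a b] True nz s s0 by fastforce
  next
    case False
    then have n3: "n \<ge> 3" using n by simp
    have W: "T (hwv n l m (segment n s)) \<in> WW n m l" by (intro T_linear hwv_in_WW)
    then have ab: "a \<in> Wl_basis n m" "b \<in> Wl_basis n l" using nz by (auto simp: WW_iff)
    define c d where "c = vac n l" and "d = fill n m (segment n s)"
    have cd: "(c, d) \<in> occupancy n l m (segment n s)"
      unfolding c_def d_def using n s seg by (intro fill_in_occupancy) auto
    have dc: "d \<in> Wl_basis n m" "c \<in> Wl_basis n l" using cd by (auto simp: occupancy_def)
    have "weight n p (Suc p) a * weight n p (Suc p) b = weight n p (Suc p) d * weight n p (Suc p) c"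
      if p: "p < n - 1" for p
    proof -
      have "cartan n p (Suc p) (T (hwv n l m (segment n s))) = T (cartan n p (Suc p) (hwv n l m (segment n s)))"
        using T_intertwiner p hwv_in_WW by (simp add: bar_intertwiner_def)
      also have "\<dots> = smul (weight n p (Suc p) c * weight n p (Suc p) d) (T (hwv n l m (segment n s)))"
        unfolding cartan_hwv[OF n cd seg(2) p] by (rule T_linear(3)[OF hwv_in_WW])
      finally have "coord (cartan n p (Suc p) (T (hwv n l m (segment n s)))) (a, b) =
        weight n p (Suc p) c * weight n p (Suc p) d * coord (T (hwv n l m (segment n s))) (a, b)" by simp
      then show ?thesis using nz by (simp add: coord_cartan mult.commute)
    qed
    then have "a ! p + b ! p = d ! p + c ! p" if "p < n - 1" for p
      using weights_separate[OF n3 ab dc _ that] by blast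
    then show ?thesis using ab cd by (simp add: occupancy_def add.commute)
  qed
qed

lemma T_hwv_multiple:
  assumes s: "s \<le> n - 1" "s \<le> l" "s \<le> m"
  shows "\<exists>c. T (hwv n l m (segment n s)) = smul c (hwv n m l (segment n s))"
proof -
  note seg = segment_simps[OF s(1)]
  let ?u = "T (hwv n l m (segment n s))" and ?h = "hwv n m l (segment n s)"
  let ?k = "(vac n m, fill n l (segment n s))"
  have n1: "n \<ge> 1" using n by simp
  define c where "c = coord ?u ?k / coord ?h ?k"
  have k: "?k \<in> occupancy n m l (segment n s)" using s seg n1 by (intro fill_in_occupancy) auto
  have uW: "?u \<in> WW n m l" by (intro T_linear hwv_in_WW)
  have "?u - smul c ?h = 0"
  proof (rule raise_kernel[OF n])
    show "?u - smul c ?h \<in> WW n m l" using uW hwv_in_WW by (intro WW_closed)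
    fix p assume p: "p < n - 1"
    have "raise n p ?u = T (raise n p (hwv n l m (segment n s)))"
      using T_intertwiner p hwv_in_WW by (simp add: bar_intertwiner_def)
    also have "\<dots> = 0" using raise_hwv[OF n seg(2,3) _ _ p] s seg(1) T_linear(4) by simp
    finally have "raise n p ?u = 0" .
    moreover have "raise n p ?h = 0" using raise_hwv[OF n seg(2,3) _ _ p] s seg(1) by simp
    ultimately show "raise n p (?u - smul c ?h) = 0" by (simp add: raise_def hop2_linear)
  next
    fix b
    show "coord (?u - smul c ?h) (vac n m, b) = 0"
    proof (cases "(vac n m, b) \<in> occupancy n m l (segment n s)")
      case True
      then have "b = fill n l (segment n s)" using occupancy_vac[OF n1 _ seg(2)] by blast
      then show ?thesis using k by (simp add: lookup_minus c_def coord_hwv)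
    next
      case False
      then show ?thesis using T_support[OF s] by (auto simp: lookup_minus coord_hwv)
    qed
  qed
  then show ?thesis by auto
qed

text \<open>Applying \<open>f\<^sub>1 \<cdots> f\<^sub>n\<^sub>-\<^sub>s\<^sub>-\<^sub>2\<close> to both sides brings the first fermion to site 0.\<close>

lemma T_hwv_move:
  assumes s: "Suc s \<le> n - 1"
    and c: "T (hwv n l m (segment n (Suc s))) = smul c (hwv n m l (segment n (Suc s)))"
  shows "T (hwv n l m (insert 0 (segment n s))) = smul c (hwv n m l (insert 0 (segment n s)))"
proof -
  have "0 \<le> n - 1 - Suc s" by simp
  then show ?thesis
  proof (induction rule: inc_induct)
    case base
    have "insert (n - 1 - Suc s) (segment n s) = segment n (Suc s)"
      using s by (auto simp: segment_def)
    then show ?case using c by simp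
  next
    case (step p)
    have C: "Suc p \<notin> segment n s" "p \<notin> segment n s" using step s by (auto simp: segment_def)
    then have "insert p (insert (Suc p) (segment n s) - {Suc p}) = insert p (segment n s)" by auto
    moreover have "finite (segment n s)" by (simp add: segment_def)
    ultimately have low: "lower n p (hwv n l m (insert (Suc p) (segment n s))) = hwv n l m (insert p (segment n s))"
      for l m using lower_hwv[OF n, of p "insert (Suc p) (segment n s)"] C step by auto
    have "T (lower n p (hwv n l m (insert (Suc p) (segment n s)))) =
      lower n p (T (hwv n l m (insert (Suc p) (segment n s))))"
      using T_intertwiner hwv_in_WW step by (simp add: bar_intertwiner_def)
    also have "\<dots> = smul c (lower n p (hwv n m l (insert (Suc p) (segment n s))))"
      unfolding step.IH by (simp add: lower_def hop2_linear)
    finally show ?case unfolding low .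
  qed
qed

lemma hwv_nonzero:
  assumes "s \<le> n - 1" "s \<le> m'"
  shows "hwv n l' m' (segment n s) \<noteq> 0"
proof
  assume *: "hwv n l' m' (segment n s) = 0"
  have "(vac n l', fill n m' (segment n s)) \<in> occupancy n l' m' (segment n s)"
    using assms n segment_simps[OF assms(1)] by (intro fill_in_occupancy) auto
  then have "coord (hwv n l' m' (segment n s)) (vac n l', fill n m' (segment n s)) \<noteq> 0"
    by (simp add: coord_hwv)
  then show False using * by simp
qed

lemma T_hwv:
  assumes "s \<le> n - 1" "s \<le> l" "s \<le> m"
  shows "T (hwv n l m (segment n s)) =
    smul (\<Prod>i = 1..s. (1 - qpar ^ (l + m - 2 * i + 2) * (xpar / ypar)) /
        (xpar / ypar - qpar ^ (l + m - 2 * i + 2)))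
      (hwv n m l (segment n s))"
  using assms
proof (induction s)
  case 0
  then show ?case using T_vacuum by (simp add: segment_def)
next
  case (Suc s)
  let ?\<rho> = "\<Prod>i = 1..s. (1 - qpar ^ (l + m - 2 * i + 2) * (xpar / ypar)) /
    (xpar / ypar - qpar ^ (l + m - 2 * i + 2))"
  let ?Q = "qpar ^ (l + m - 2 * s)"
  have seg: "card (segment n s) = s" "segment n s \<subseteq> {..<n - 1}" "0 \<notin> segment n s"
    using Suc.prems by (auto simp: segment_def)
  have aff: "affine_raise n x y (hwv n l m (insert 0 (segment n s))) =
      smul (inverse x - ?Q * inverse y) (hwv n l m (segment n s))"
    "affine_raise n x y (hwv n m l (insert 0 (segment n s))) =
      smul (inverse x - ?Q * inverse y) (hwv n m l (segment n s))" for x y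
    using affine_raise_hwv[OF n seg(3,2), of l m x y] affine_raise_hwv[OF n seg(3,2), of m l x y]
      Suc.prems seg(1) by (simp_all add: add.commute)
  obtain c where c: "T (hwv n l m (segment n (Suc s))) = smul c (hwv n m l (segment n (Suc s)))"
    using T_hwv_multiple[OF Suc.prems] by blast
  have "T (affine_raise n xpar ypar (hwv n l m (insert 0 (segment n s)))) =
    affine_raise n ypar xpar (T (hwv n l m (insert 0 (segment n s))))"
    by (rule T_affine(1)[OF hwv_in_WW])
  then have "smul ((inverse xpar - ?Q * inverse ypar) * ?\<rho>) (hwv n m l (segment n s)) =
      smul (c * (inverse ypar - ?Q * inverse xpar)) (hwv n m l (segment n s))"
    using Suc.IH Suc.prems
    unfolding T_hwv_move[OF Suc.prems(1) c] affine_linear aff T_linear(3)[OF hwv_in_WW] by simp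
  then have "smul ((inverse xpar - ?Q * inverse ypar) * ?\<rho> - c * (inverse ypar - ?Q * inverse xpar))
      (hwv n m l (segment n s)) = 0"
    by (simp only: smul_diff_left diff_self)
  then have eq: "c * (inverse ypar - ?Q * inverse xpar) = (inverse xpar - ?Q * inverse ypar) * ?\<rho>"
    using hwv_nonzero[of s l m] Suc.prems by (simp add: smul_eq_0_iff)
  have e1: "inverse x - Q * inverse y = (1 - Q * (x / y)) / x" if "x \<noteq> 0" "y \<noteq> 0" for Q x y :: scal
    using that by (simp add: divide_simps)
  have e2: "inverse y - Q * inverse x = (x / y - Q) / x" if "x \<noteq> 0" "y \<noteq> 0" for Q x y :: scal
    using that by (simp add: divide_simps)
  have nz: "xpar / ypar - ?Q \<noteq> 0"
    using xpar_minus_power_ypar[of "l + m - 2 * s"] by (simp add: divide_simps)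
  have solve: "c = A / B * r" if "c * (B / x) = A / x * r" "B \<noteq> 0" "x \<noteq> 0" for A B r x :: scal
    using that by (simp add: divide_simps)
  have "c = (1 - ?Q * (xpar / ypar)) / (xpar / ypar - ?Q) * ?\<rho>"
    by (rule solve[OF _ nz xpar_nonzero])
       (use eq in \<open>simp only: e1[OF xpar_nonzero ypar_nonzero] e2[OF xpar_nonzero ypar_nonzero]\<close>)
  moreover have "l + m - 2 * Suc s + 2 = l + m - 2 * s" using Suc.prems by simp
  ultimately have "c = (\<Prod>i = 1..Suc s. (1 - qpar ^ (l + m - 2 * i + 2) * (xpar / ypar)) /
    (xpar / ypar - qpar ^ (l + m - 2 * i + 2)))"
    by (simp only: prod.cl_ivl_Suc) (simp add: mult.commute)
  then show ?case using c by simp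
qed

end

section \<open>The spectral decomposition\<close>

lemma bar_intertwiner_combination:
  fixes S :: "nat set"
  assumes T: "bar_intertwiner n l m T" and P: "\<And>s. s \<in> S \<Longrightarrow> bar_intertwiner n l m (P s)" and n: "n \<ge> 2"
  shows "bar_intertwiner n l m (\<lambda>t. T t - (\<Sum>s\<in>S. smul (c s) (P s t)))"
proof -
  let ?T = "\<lambda>t. T t - (\<Sum>s\<in>S. smul (c s) (P s t))"
  note linT = bar_intertwiner_linear[OF T] and linP = bar_intertwiner_linear[OF P]
  have gen: "G (?T t) = ?T (F t)"
    if G: "\<And>u v. G (u - v) = G u - G v" "\<And>u v. G (u + v) = G u + G v" "\<And>d u. G (smul d u) = smul d (G u)"
      and TG: "T (F t) = G (T t)" "\<And>s. s \<in> S \<Longrightarrow> P s (F t) = G (P s t)"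
    for F G :: "(nat list \<times> nat list \<Rightarrow>\<^sub>0 scal) \<Rightarrow> (nat list \<times> nat list \<Rightarrow>\<^sub>0 scal)" and t
  proof -
    have "G 0 = 0" using G(3)[of 0 0] by simp
    then have "G (\<Sum>s\<in>A. f s) = (\<Sum>s\<in>A. G (f s))" for A and f :: "nat \<Rightarrow> _"
      by (induction A rule: infinite_finite_induct) (auto simp: G)
    moreover have "(\<Sum>s\<in>S. smul (c s) (P s (F t))) = (\<Sum>s\<in>S. smul (c s) (G (P s t)))"
      by (rule sum.cong[OF refl]) (simp add: TG)
    ultimately show ?thesis by (simp add: G TG(1))
  qed
  have Tc: "T (raise n p t) = raise n p (T t)" "T (lower n p t) = lower n p (T t)"
    "T (cartan n p (Suc p) t) = cartan n p (Suc p) (T t)" if "p < n - 1" "t \<in> WW n l m" for p t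
    using T that by (auto simp: bar_intertwiner_def)
  have Pc: "P s (raise n p t) = raise n p (P s t)" "P s (lower n p t) = lower n p (P s t)"
    "P s (cartan n p (Suc p) t) = cartan n p (Suc p) (P s t)" if "p < n - 1" "t \<in> WW n l m" "s \<in> S" for p t s
    using P[OF that(3)] that by (auto simp: bar_intertwiner_def)
  have lin: "linear_between (WW n l m) (WW n m l) ?T"
    unfolding linear_between_def
  proof (intro conjI ballI allI)
    fix u v assume u: "u \<in> WW n l m" and v: "v \<in> WW n l m"
    show "?T u \<in> WW n m l" using u by (intro WW_closed WW_sum linT linP)
    have "(\<Sum>s\<in>S. smul (c s) (P s (u + v))) = (\<Sum>s\<in>S. smul (c s) (P s u) + smul (c s) (P s v))"
      by (rule sum.cong[OF refl]) (simp add: linP(2)[OF _ u v] smul_add)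
    then show "?T (u + v) = ?T u + ?T v" by (simp add: linT(2)[OF u v] sum.distrib)
  next
    fix d u assume u: "u \<in> WW n l m"
    have "(\<Sum>s\<in>S. smul (c s) (P s (smul d u))) = (\<Sum>s\<in>S. smul d (smul (c s) (P s u)))"
      by (rule sum.cong[OF refl]) (simp add: linP(3)[OF _ u] mult.commute)
    then show "?T (smul d u) = smul d (?T u)" by (simp add: linT(3)[OF u] smul_diff smul_sum)
  qed
  show ?thesis
    unfolding bar_intertwiner_def
  proof (intro conjI lin allI impI ballI)
    fix p t assume p: "p < n - 1" and t: "t \<in> WW n l m"
    show "?T (raise n p t) = raise n p (?T t)"
      by (rule gen[symmetric]) (simp_all add: Tc[OF p t] Pc[OF p t] raise_linear)
    show "?T (lower n p t) = lower n p (?T t)"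
      by (rule gen[symmetric]) (simp_all add: Tc[OF p t] Pc[OF p t] lower_linear)
    show "?T (cartan n p (Suc p) t) = cartan n p (Suc p) (?T t)"
      by (rule gen[symmetric]) (simp_all add: Tc[OF p t] Pc[OF p t] cartan_linear)
  qed
qed

theorem mainTheorem9:
  fixes n l m :: nat
    and R :: "(nat list \<times> nat list \<Rightarrow>\<^sub>0 scal) \<Rightarrow> (nat list \<times> nat list \<Rightarrow>\<^sub>0 scal)"
    and scrP :: "nat \<Rightarrow> (nat list \<times> nat list \<Rightarrow>\<^sub>0 scal) \<Rightarrow> (nat list \<times> nat list \<Rightarrow>\<^sub>0 scal)"
    and z :: scal
  assumes "n \<ge> 2"
    and "z = xpar / ypar"
    and "is_quantum_R n l m R"
    and "\<And>s. s \<le> Min {n - 1, l, m} \<Longrightarrow> is_scrP n l m s (scrP s)"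
  shows "\<forall>t \<in> WW n l m.
    flip (R t) =
      (\<Sum>s = 0..Min {n - 1, l, m}.
         smul (\<Prod>i = 1..s. (1 - qpar ^ (l + m - 2 * i + 2) * z) / (z - qpar ^ (l + m - 2 * i + 2)))
           (scrP s t))"
proof
  fix t assume t: "t \<in> WW n l m"
  interpret quantum_R n l m R using assms by unfold_locales
  let ?M = "Min {n - 1, l, m}"
  let ?\<rho> = "\<lambda>s. \<Prod>i = 1..s. (1 - qpar ^ (l + m - 2 * i + 2) * z) / (z - qpar ^ (l + m - 2 * i + 2))"
  have M: "s \<le> ?M \<longleftrightarrow> s \<le> n - 1 \<and> s \<le> l \<and> s \<le> m" for s by simp
  have P: "bar_intertwiner n l m (scrP s)" if "s \<le> ?M" for s
    using scrP_bar_intertwiner[OF assms(1) assms(4)[OF that]] .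
  have xi: "xi n l m s = hwv n l m (segment n s)" "xi n m l s = hwv n m l (segment n s)" if "s \<le> ?M" for s
    using that assms(1) by (auto intro!: xi_eq_hwv)
  have P_hwv: "scrP s (hwv n l m (segment n s')) = (if s = s' then hwv n m l (segment n s) else 0)"
    if "s \<le> ?M" "s' \<le> ?M" for s s'
    using assms(4)[OF that(1)] that xi unfolding is_scrP_def by metis
  have T: "bar_intertwiner n l m (\<lambda>t. T t - (\<Sum>s\<in>{0..?M}. smul (?\<rho> s) (scrP s t)))"
    by (rule bar_intertwiner_combination[OF T_intertwiner P assms(1)]) simp
  have "T t - (\<Sum>s\<in>{0..?M}. smul (?\<rho> s) (scrP s t)) = 0"
  proof (rule intertwiner_eq_0[OF assms(1) T, where P = scrP, OF _ _ _ _ t])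
    fix s assume s: "s \<le> n - 1" "s \<le> l" "s \<le> m"
    then have sM: "s \<le> ?M" using M by blast
    show "bar_intertwiner n l m (scrP s)" using P sM by blast
    show "scrP s (hwv n l m (segment n s')) = 0" if "s' < s" for s'
    proof -
      have "s' \<le> ?M" using that sM by linarith
      then show ?thesis using P_hwv[OF sM, of s'] that by simp
    qed
    show "scrP s (hwv n l m (segment n s)) \<noteq> 0" using P_hwv[OF sM sM] hwv_nonzero[of s l m] s by simp
    have "(\<Sum>r\<in>{0..?M}. smul (?\<rho> r) (scrP r (hwv n l m (segment n s)))) =
        (\<Sum>r\<in>{0..?M}. if r = s then smul (?\<rho> s) (hwv n m l (segment n s)) else 0)"
    proof (rule sum.cong[OF refl])
      fix r assume "r \<in> {0..?M}"
      then have r: "r \<le> ?M" by (simp only: atLeastAtMost_iff)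
      show "smul (?\<rho> r) (scrP r (hwv n l m (segment n s))) =
          (if r = s then smul (?\<rho> s) (hwv n m l (segment n s)) else 0)"
        unfolding P_hwv[OF r sM] by (cases "r = s") simp_all
    qed
    also have "\<dots> = smul (?\<rho> s) (hwv n m l (segment n s))" using sM by (subst sum.delta) auto
    finally show "T (hwv n l m (segment n s)) -
        (\<Sum>r\<in>{0..?M}. smul (?\<rho> r) (scrP r (hwv n l m (segment n s)))) = 0"
      using T_hwv[OF s] assms(2) by simp
  qed
  then show "flip (R t) = (\<Sum>s = 0..?M. smul (?\<rho> s) (scrP s t))" by (simp add: T_def)
qed

end
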